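(* Let $n\ge2$, $1\le k<n$, $\alpha_1>0$, $\alpha_2>\alpha_3>0$, and let $S_{AV}=\{i_1,\dots,i_k\}\subseteq\{1,\dots,n\}$ be the set of AV indices. For the mixed traffic system $\dot x=A_kx+B_ku$ (defined in the context): (1) $(A_k,B_k)$ is not completely controllable; the vector $w=(1,0,1,0,\dots,1,0)^{\mathsf T}\in\mathbb R^{2n}$ satisfies $w^{\mathsf T}A_k=0$, $w^{\mathsf T}B_k=0$, so $\sum_{i=1}^n\tilde s_i(t)$ is constant along all trajectories, and $0$ is an uncontrollable eigenvalue whose algebraic multiplicity in the uncontrollable part is one. (2) $(A_k,B_k)$ is stabilizable in the sense that every eigenvalue $\lambda$ of $A_k$ with $\operatorname{rank}[\lambda I-A_k,\ B_k]<2n$ satisfies $\lambda=0$ or $\operatorname{Re}\lambda<0$; equivalently there exists $K\in\mathbb R^{k\times2n}$ such that $A_k-B_kK$ has a simple eigenvalue $0$ and all other eigenvalues with negative real part.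
   Context: $n$ vehicles on a single-lane ring road; vehicle $i$ follows vehicle $i-1$, vehicle $1$ follows vehicle $n$. Vehicles with index in $S_{AV}$ are autonomous (acceleration is a control input), the others human-driven. State $x=(\tilde s_1,\tilde v_1,\dots,\tilde s_n,\tilde v_n)^{\mathsf T}$, input $u=(u_{i_1},\dots,u_{i_k})^{\mathsf T}$. Define $A_1=\begin{bmatrix}0&-1\\ \alpha_1&-\alpha_2\end{bmatrix}$, $A_2=\begin{bmatrix}0&1\\0&\alpha_3\end{bmatrix}$, $C_1=\begin{bmatrix}0&-1\\0&0\end{bmatrix}$, $C_2=\begin{bmatrix}0&1\\0&0\end{bmatrix}$. $A_k$ is the $n\times n$ block matrix with $2\times 2$ blocks where, for each $r=1,\dots,n$, block $(r,r)$ is $C_1$ if $r\in S_{AV}$ and $A_1$ otherwise, block $(r,r-1)$ (with $r-1$ read as $n$ when $r=1$) is $C_2$ if $r\in S_{AV}$ and $A_2$ otherwise, and all other blocks are zero. $B_k=[P_1,\dots,P_k]\in\mathbb R^{2n\times k}$, where $P_r$ is the $2n$-vector with a $1$ in entry $2i_r$ and zeros elsewhere. *)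

theory Defs
  imports "Jordan_Normal_Form.Jordan_Normal_Form" "Jordan_Normal_Form.DL_Rank"
begin

definition blkA1 :: "real \<Rightarrow> real \<Rightarrow> real mat" where
  "blkA1 a1 a2 = mat_of_rows_list 2 [[0, -1], [a1, -a2]]"

definition blkA2 :: "real \<Rightarrow> real mat" where
  "blkA2 a3 = mat_of_rows_list 2 [[0, 1], [0, a3]]"

definition blkC1 :: "real mat" where
  "blkC1 = mat_of_rows_list 2 [[0, -1], [0, 0]]"

definition blkC2 :: "real mat" where
  "blkC2 = mat_of_rows_list 2 [[0, 1], [0, 0]]"

text \<open>System matrix A_k. Vehicles are numbered 1..n (S is a subset of {1..n});
  matrix rows/columns are 0-based: vehicle r occupies rows/columns 2(r-1) (spacing)
  and 2(r-1)+1 (velocity). Block (r,r) is C1/A1, block (r,r-1) (r-1 read as n when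
  r = 1) is C2/A2, depending on whether r is an AV.\<close>

definition mixed_A :: "nat \<Rightarrow> nat set \<Rightarrow> real \<Rightarrow> real \<Rightarrow> real \<Rightarrow> real mat" where
  "mixed_A n S a1 a2 a3 = mat (2*n) (2*n) (\<lambda>(i,j).
     let r = i div 2 + 1; c = j div 2 + 1; p = (if r = 1 then n else r - 1) in
     if c = r then (if r \<in> S then blkC1 else blkA1 a1 a2) $$ (i mod 2, j mod 2)
     else if c = p then (if r \<in> S then blkC2 else blkA2 a3) $$ (i mod 2, j mod 2)
     else 0)"

text \<open>Input matrix B_k = [P_1,...,P_k], with S = {i_1 < ... < i_k}; P_r has a 1 in
  (1-based) entry 2 i_r, i.e. 0-based row 2 i_r - 1.\<close>

definition mixed_B :: "nat \<Rightarrow> nat set \<Rightarrow> real mat" where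
  "mixed_B n S = mat (2*n) (card S) (\<lambda>(i,j).
     if i + 1 = 2 * (sorted_list_of_set S ! j) then 1 else 0)"

definition ctrb_matrix :: "'a::field mat \<Rightarrow> 'a mat \<Rightarrow> 'a mat" where
  "ctrb_matrix A B = mat (dim_row A) (dim_col B * dim_row A) (\<lambda>(i,j).
     ((A ^\<^sub>m (j div dim_col B)) * B) $$ (i, j mod dim_col B))"

definition completely_controllable :: "'a::field mat \<Rightarrow> 'a mat \<Rightarrow> bool" where
  "completely_controllable A B \<longleftrightarrow>
     vec_space.rank (dim_row A) (ctrb_matrix A B) = dim_row A"

definition pbh_matrix :: "'a::field mat \<Rightarrow> 'a mat \<Rightarrow> 'a \<Rightarrow> 'a mat" where
  "pbh_matrix A B l = mat (dim_row A) (dim_row A + dim_col B) (\<lambda>(i,j).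
     if j < dim_row A then (l \<cdot>\<^sub>m 1\<^sub>m (dim_row A) - A) $$ (i,j)
     else B $$ (i, j - dim_row A))"

text \<open>Kalman controllability decomposition: T A T^{-1} = [[A11, A12],[0, A22]],
  T B = [[B1],[0]] with (A11, B1) completely controllable; A22 is the uncontrollable part.\<close>

definition kalman_decomp ::
  "'a::field mat \<Rightarrow> 'a mat \<Rightarrow> 'a mat \<Rightarrow> 'a mat \<Rightarrow> 'a mat \<Rightarrow> 'a mat \<Rightarrow> 'a mat \<Rightarrow> bool" where
  "kalman_decomp A B T A11 A12 A22 B1 \<longleftrightarrow>
     (let N = dim_row A; k = dim_col B; r = dim_row A11 in
      A \<in> carrier_mat N N \<and> B \<in> carrier_mat N k \<and> r \<le> N \<and>
      T \<in> carrier_mat N N \<and> invertible_mat T \<and>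
      A11 \<in> carrier_mat r r \<and> A12 \<in> carrier_mat r (N - r) \<and>
      A22 \<in> carrier_mat (N - r) (N - r) \<and> B1 \<in> carrier_mat r k \<and>
      T * A = four_block_mat A11 A12 (0\<^sub>m (N - r) r) A22 * T \<and>
      T * B = B1 @\<^sub>r 0\<^sub>m (N - r) k \<and>
      completely_controllable A11 B1)"

end

theory Submission
  imports Defs
begin

text \<open>Everything follows from one feedback $K$: let a single AV use $u = -\tilde v$ and let every
  other AV imitate a human driver. This opens the ring; in the order
  $\tilde v_s, \tilde s_{s+1}, \tilde v_{s+1}, \dots, \tilde s_s$ the closed loop is block
  triangular with characteristic polynomial $X (X+1) (X^2 + \alpha_2 X + \alpha_1)^{n-1}$.
  A left vector witnessing a rank defect of $[\lambda I - A, B]$ is a left eigenvector of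
  $A - BK$, so uncontrollable eigenvalues are $0$ or stable. The characteristic polynomial of the
  uncontrollable part divides that of $A - BK$, so $0$ has multiplicity at most one there; it has
  multiplicity at least one because of the left kernel vector $w$.\<close>

section \<open>Rank and left kernel\<close>

text \<open>Without feedback the velocity row of every AV is zero and \<open>A\<close> has the
  characteristic polynomial X^(2k) (X^2 + a2 X + a1)^(n-k): the multiplicity 2k of 0 is too large to
  bound the one in the uncontrollable part. If all AVs imitated human drivers, the polynomial would
  be (X^2 + a2 X + a1)^n - (a3 X + a1)^n, where the subtracted term comes from the path once around
  the ring and makes the roots hard to locate. Exempting one AV removes that term. Since no feedback
  alters the uncontrollable part, this single explicit spectrum suffices, and neither the reachable
  subspace nor its dimension has to be determined. Rank conditions are dualized throughout: full row
  rank means that the transposed matrix kills no nonzero vector, so controllability, the PBH test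
  and the conserved sum all become statements on left vectors. The general results hold over any
  field, because the PBH test is applied over the complex numbers while the Kalman decomposition and
  \<open>K\<close> are real.\<close>

lemma mult_mat_unit_vec:
  fixes M :: "'a :: semiring_1 mat"
  assumes "M \<in> carrier_mat nr nc" and "j < nc"
  shows "M *\<^sub>v unit_vec nc j = col M j"
  by (rule eq_vecI) (use assms in auto)

lemma (in vec_space) rank_le_dim:
  assumes M: "M \<in> carrier_mat n nc"
  shows "rank M \<le> n"
proof -
  let ?C = "set (cols M)"
  have "lin_indpt {}" by (rule finite_lin_indpt2) auto
  then obtain S where S: "maximal S (\<lambda>T. T \<subseteq> ?C \<and> lin_indpt T)"
    using maximal_exists_superset[of ?C "\<lambda>T. T \<subseteq> ?C \<and> lin_indpt T" "{}"] by auto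
  then have "lin_indpt S" "S \<subseteq> carrier_vec n"
    using cols_dim[of M] M by (auto simp: maximal_def)
  then show ?thesis
    using li_le_dim(2)[OF fin_dim] dim_is_n rank_card_indpt[OF M S] by auto
qed

text \<open>A maximal independent set \<open>S\<close> of columns spans all columns, hence has the
  same annihilator. Written as the rows of a square matrix, \<open>S\<close> has a trivial kernel
  exactly if the determinant is nonzero, that is, if \<open>S\<close> has \<open>n\<close>
  elements.\<close>

lemma (in vec_space) rank_eq_dim_iff_trivial_left_kernel:
  assumes M: "M \<in> carrier_mat n nc"
  shows "rank M = n \<longleftrightarrow> (\<forall>y \<in> carrier_vec n. transpose_mat M *\<^sub>v y = 0\<^sub>v nc \<longrightarrow> y = 0\<^sub>v n)"
proof -
  let ?C = "set (cols M)"
  have CC: "?C \<subseteq> carrier_vec n" using cols_dim M by blast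
  have annih: "transpose_mat M *\<^sub>v y = 0\<^sub>v nc \<longleftrightarrow> (\<forall>c \<in> ?C. c \<bullet> y = 0)" for y
  proof -
    have "transpose_mat M *\<^sub>v y = 0\<^sub>v nc \<longleftrightarrow> (\<forall>j<nc. col M j \<bullet> y = 0)"
      using M by (auto simp: vec_eq_iff)
    also have "\<dots> \<longleftrightarrow> (\<forall>c \<in> ?C. c \<bullet> y = 0)"
      using M by (auto simp: cols_def)
    finally show ?thesis .
  qed
  have "lin_indpt {}" by (rule finite_lin_indpt2) auto
  then obtain S where S: "maximal S (\<lambda>T. T \<subseteq> ?C \<and> lin_indpt T)" and finS: "finite S"
    using maximal_exists_superset[of ?C "\<lambda>T. T \<subseteq> ?C \<and> lin_indpt T" "{}"] by auto
  have SC: "S \<subseteq> ?C" and li: "lin_indpt S" using S by (auto simp: maximal_def)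
  have Sn: "S \<subseteq> carrier_vec n" using SC CC by auto
  have rk: "rank M = card S" by (rule rank_card_indpt[OF M S])
  have span: "?C \<subseteq> span S"
  proof
    fix c assume c: "c \<in> ?C"
    show "c \<in> span S"
    proof (rule ccontr)
      assume nc: "c \<notin> span S"
      then have nS: "c \<notin> S" using Sn span_mem by auto
      have "lin_indpt (S \<union> {c})"
        using lin_dep_iff_in_span[of S c] Sn li c CC nS nc by auto
      then have "S \<union> {c} = S" using S c SC unfolding maximal_def by blast
      then show False using nS by auto
    qed
  qed
  have annS: "(\<forall>c \<in> ?C. c \<bullet> y = 0) \<longleftrightarrow> (\<forall>c \<in> S. c \<bullet> y = 0)" if y: "y \<in> carrier_vec n" for y
  proof
    assume "\<forall>c \<in> S. c \<bullet> y = 0"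
    then have "y \<in> orthogonal_complement S"
      unfolding orthogonal_complement_def using y Sn comm_scalar_prod by fastforce
    then have "y \<in> orthogonal_complement (span S)" using in_orthogonal_complement_span[OF Sn] by simp
    then show "\<forall>c \<in> ?C. c \<bullet> y = 0"
      unfolding orthogonal_complement_def using y CC span comm_scalar_prod by fastforce
  qed (use SC in auto)
  have crd: "card S \<le> n" using li_le_dim(2)[OF fin_dim _ li] Sn dim_is_n by auto
  obtain xs where xs: "set xs = S" "distinct xs" using finite_distinct_list[OF finS] by auto
  \<comment> \<open>Zero rows make \<open>D\<close> square without changing its kernel; a single one
    of them already makes \<open>D\<close> singular.\<close>
  define ys where "ys = xs @ replicate (n - card S) (0\<^sub>v n)"
  have lys: "length ys = n" unfolding ys_def using crd xs distinct_card by fastforce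
  have ysn: "set ys \<subseteq> carrier_vec n" unfolding ys_def using xs Sn by auto
  define D where "D = mat_of_rows n ys"
  have D: "D \<in> carrier_mat n n" unfolding D_def using lys by (metis mat_of_rows_carrier(1))
  have rD: "row D i = ys ! i" if "i < n" for i
    unfolding D_def using that lys ysn by (auto intro!: mat_of_rows_row)
  have Dy: "D *\<^sub>v y = 0\<^sub>v n \<longleftrightarrow> (\<forall>c \<in> set ys. c \<bullet> y = 0)" for y
  proof -
    have "D *\<^sub>v y = 0\<^sub>v n \<longleftrightarrow> (\<forall>i<n. row D i \<bullet> y = 0)"
      using D by (auto simp: vec_eq_iff)
    also have "\<dots> \<longleftrightarrow> (\<forall>i<length ys. ys ! i \<bullet> y = 0)" using rD lys by auto
    finally show ?thesis by (simp add: all_set_conv_all_nth)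
  qed
  have Dy': "D *\<^sub>v y = 0\<^sub>v n \<longleftrightarrow> transpose_mat M *\<^sub>v y = 0\<^sub>v nc" if "y \<in> carrier_vec n" for y
    unfolding Dy annih annS[OF that] ys_def using xs that by auto
  have "(\<forall>y \<in> carrier_vec n. transpose_mat M *\<^sub>v y = 0\<^sub>v nc \<longrightarrow> y = 0\<^sub>v n) \<longleftrightarrow> det D \<noteq> 0"
    unfolding det_0_iff_vec_prod_zero_field[OF D] using Dy' by blast
  also have "\<dots> \<longleftrightarrow> card S = n"
  proof
    assume n: "card S = n"
    have Dt: "transpose_mat D \<in> carrier_mat n n" using D by simp
    have c: "cols (transpose_mat D) = xs"
      unfolding cols_transpose D_def ys_def n
      using Sn xs by (simp add: rows_mat_of_rows)
    have "rank (transpose_mat D) = n"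
      by (rule lin_indpt_full_rank[OF Dt]) (use c xs li in auto)
    then show "det D \<noteq> 0" using det_rank_iff[OF Dt] det_transpose[OF D] by auto
  next
    assume d: "det D \<noteq> 0"
    show "card S = n"
    proof (rule ccontr)
      assume "card S \<noteq> n"
      then have lt: "card S < n" using crd by auto
      have "ys ! (n-1) = 0\<^sub>v n" unfolding ys_def
        using lt xs distinct_card[OF xs(2)] by (auto simp: nth_append)
      then have "row D (n-1) = 0\<^sub>v n" using rD lt by auto
      then have "transpose_mat D *\<^sub>v unit_vec n (n-1) = 0\<^sub>v n"
        using D lt by (simp add: mult_mat_unit_vec)
      moreover have "(unit_vec n (n-1) :: 'a vec) \<noteq> 0\<^sub>v n" using lt by simp
      ultimately have "det (transpose_mat D) = 0"
        using det_0_iff_vec_prod_zero_field[of "transpose_mat D" n] transpose_carrier_mat[THEN iffD2, OF D] unit_vec_carrier by blast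
      then show False using d det_transpose[OF D] by simp
    qed
  qed
  finally show ?thesis using rk by simp
qed

section \<open>Controllability by left vectors\<close>

text \<open>Used with \<open>F\<close> the transpose of \<open>A\<close>, so that y^T A^j B = 0
  becomes a condition on the orbit of one vector, and invariance under \<open>F\<close> is a shift
  of \<open>j\<close>.\<close>

abbreviation krylov :: "'a::comm_semiring_0 mat \<Rightarrow> nat \<Rightarrow> 'a vec \<Rightarrow> 'a vec" where
  "krylov F j y \<equiv> ((*\<^sub>v) F ^^ j) y"

lemma krylov_carrier:
  assumes "F \<in> carrier_mat n n" and "y \<in> carrier_vec n"
  shows "krylov F j y \<in> carrier_vec n"
  by (induction j) (use assms in auto)

lemma transpose_pow_mult_vec:
  assumes A: "A \<in> carrier_mat n n" and y: "y \<in> carrier_vec n"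
  shows "transpose_mat (A ^\<^sub>m j) *\<^sub>v y = krylov (transpose_mat A) j y"
proof (induction j)
  case 0
  then show ?case using A y by simp
next
  case (Suc j)
  have "transpose_mat (A ^\<^sub>m Suc j) *\<^sub>v y = transpose_mat A *\<^sub>v (transpose_mat (A ^\<^sub>m j) *\<^sub>v y)"
    using A y by (simp add: transpose_mult[of _ n n _ n] assoc_mult_mat_vec[of _ n n _ n])
  then show ?case using Suc by simp
qed

text \<open>Linear relations between vectors are kept as scalar sums in each entry. Applied with
  \<open>F\<close> itself this shifts a relation along an orbit; applied with another matrix
  \<open>G\<close> it transfers the relation to the images.\<close>

lemma mult_mat_vec_sum_index:
  assumes F: "F \<in> carrier_mat m r" and v: "\<And>i. i \<in> I \<Longrightarrow> v i \<in> carrier_vec r"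
    and z: "\<And>b. b < r \<Longrightarrow> (\<Sum>i\<in>I. c i * v i $ b) = 0" and a: "a < m"
  shows "(\<Sum>i\<in>I. c i * (F *\<^sub>v v i) $ a) = (0 :: 'a :: comm_ring)"
proof -
  have "(\<Sum>i\<in>I. c i * (F *\<^sub>v v i) $ a) = (\<Sum>i\<in>I. \<Sum>b<r. c i * (F $$ (a,b) * v i $ b))"
  proof (rule sum.cong[OF refl])
    fix i assume i: "i \<in> I"
    have "(F *\<^sub>v v i) $ a = (\<Sum>b<r. F $$ (a,b) * v i $ b)"
      using F a v[OF i] by (auto simp: scalar_prod_def atLeast0LessThan intro!: sum.cong)
    then show "c i * (F *\<^sub>v v i) $ a = (\<Sum>b<r. c i * (F $$ (a,b) * v i $ b))"
      by (simp add: sum_distrib_left)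
  qed
  also have "\<dots> = (\<Sum>b<r. F $$ (a,b) * (\<Sum>i\<in>I. c i * v i $ b))"
    by (subst sum.swap) (simp add: sum_distrib_left mult_ac)
  also have "\<dots> = 0" using z by simp
  finally show ?thesis .
qed

text \<open>The vectors $y, Fy, \dots, F^r y$ are dependent in dimension $r$; this replaces the
  usual appeal to the Cayley-Hamilton theorem.\<close>

lemma krylov_kernel_stabilizes:
  fixes F :: "'a :: field mat"
  assumes F: "F \<in> carrier_mat r r" and G: "G \<in> carrier_mat k r" and y: "y \<in> carrier_vec r"
    and small: "\<And>i. i < r \<Longrightarrow> G *\<^sub>v krylov F i y = 0\<^sub>v k"
  shows "G *\<^sub>v krylov F j y = 0\<^sub>v k"
proof -
  let ?v = "\<lambda>i. krylov F i y"
  have vc: "?v i \<in> carrier_vec r" for i using krylov_carrier[OF F y] .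
  \<comment> \<open>The columns are the \<open>r + 1\<close> orbit vectors. The extra zero row makes
    \<open>D\<close> square and visibly singular, so a kernel vector supplies the coefficients of a
    dependence.\<close>
  define D where "D = mat (Suc r) (Suc r) (\<lambda>(a,i). if a < r then ?v i $ a else 0)"
  have D: "D \<in> carrier_mat (Suc r) (Suc r)" unfolding D_def by simp
  have "transpose_mat D *\<^sub>v unit_vec (Suc r) r = 0\<^sub>v (Suc r)"
    by (subst mult_mat_unit_vec[of _ "Suc r" "Suc r"]) (auto simp: D_def)
  moreover have "(unit_vec (Suc r) r :: 'a vec) \<noteq> 0\<^sub>v (Suc r)" by simp
  ultimately have "det (transpose_mat D) = 0"
    using det_0_iff_vec_prod_zero_field[of "transpose_mat D" "Suc r"]
      transpose_carrier_mat[THEN iffD2, OF D] unit_vec_carrier by blast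
  then have "det D = 0" using det_transpose[OF D] by simp
  then obtain w where w: "w \<in> carrier_vec (Suc r)" "w \<noteq> 0\<^sub>v (Suc r)" "D *\<^sub>v w = 0\<^sub>v (Suc r)"
    using det_0_iff_vec_prod_zero_field[OF D] by auto
  define c where "c i = w $ i" for i
  \<comment> \<open>The last nonzero coefficient: the relation can be solved for the vector with
    index \<open>m\<close>. As \<open>m \<le> r\<close>, all smaller indices are covered by the
    assumption \<open>small\<close>.\<close>
  define m where "m = (GREATEST i. i \<le> r \<and> c i \<noteq> 0)"
  have "\<exists>i\<le>r. c i \<noteq> 0" using w(1,2) unfolding c_def by (auto simp: vec_eq_iff less_Suc_eq_le)
  then have m: "m \<le> r" "c m \<noteq> 0"
    using GreatestI_ex_nat[of "\<lambda>i. i \<le> r \<and> c i \<noteq> 0" r] unfolding m_def by auto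
  have m_max: "c i = 0" if "m < i" "i \<le> r" for i
    using Greatest_le_nat[of "\<lambda>i. i \<le> r \<and> c i \<noteq> 0" i r] that unfolding m_def by auto
  have dep0: "(\<Sum>i\<le>m. c i * ?v i $ a) = 0" if a: "a < r" for a
  proof -
    have "(\<Sum>i\<le>m. c i * ?v i $ a) = (\<Sum>i\<le>r. c i * ?v i $ a)"
      using m m_max by (intro sum.mono_neutral_left) auto
    also have "\<dots> = (D *\<^sub>v w) $ a"
      using D w(1) a unfolding c_def
      by (auto simp: scalar_prod_def D_def atLeast0LessThan lessThan_Suc_atMost mult.commute intro!: sum.cong)
    finally show ?thesis using w(3) a by simp
  qed
  have dep: "(\<Sum>i\<le>m. c i * ?v (i + l) $ a) = 0" if "a < r" for a l
    using that
  proof (induction l arbitrary: a)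
    case (Suc l)
    show ?case using mult_mat_vec_sum_index[where I = "{..m}" and v = "\<lambda>i. ?v (i + l)" and c = c,
          OF F _ Suc.IH Suc.prems] vc by simp
  qed (simp add: dep0)
  \<comment> \<open>For \<open>j = m + l\<close> the relation shifted by \<open>l\<close> expresses
    the new vector by earlier ones, which \<open>G\<close> kills by the induction
    hypothesis.\<close>
  show ?thesis
  proof (induction j rule: less_induct)
    case (less j)
    show ?case
    proof (cases "j < m")
      case True
      then show ?thesis using small m by simp
    next
      case False
      define l where "l = j - m"
      have j: "j = m + l" using False l_def by simp
      have "(G *\<^sub>v ?v j) $ a = 0" if a: "a < k" for a
      proof -
        have "0 = (\<Sum>i\<le>m. c i * (G *\<^sub>v ?v (i + l)) $ a)"
          using mult_mat_vec_sum_index[where I = "{..m}" and v = "\<lambda>i. ?v (i + l)" and c = c, OF G _ dep a] vc by simp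
        also have "\<dots> = c m * (G *\<^sub>v ?v (m + l)) $ a + (\<Sum>i<m. c i * (G *\<^sub>v ?v (i + l)) $ a)"
          by (simp add: lessThan_Suc_atMost[symmetric] add.commute)
        also have "(\<Sum>i<m. c i * (G *\<^sub>v ?v (i + l)) $ a) = 0"
        proof (rule sum.neutral, safe)
          fix i assume "i < m"
          then have "G *\<^sub>v ?v (i + l) = 0\<^sub>v k" using less j by auto
          then show "c i * (G *\<^sub>v ?v (i + l)) $ a = 0" using a by simp
        qed
        finally show ?thesis using m(2) j by simp
      qed
      then show ?thesis using G by (auto simp: vec_eq_iff)
    qed
  qed
qed

lemma ctrb_matrix_carrier:
  "A \<in> carrier_mat n n \<Longrightarrow> B \<in> carrier_mat n k \<Longrightarrow> ctrb_matrix A B \<in> carrier_mat n (k * n)"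
  by (auto simp: ctrb_matrix_def)

text \<open>Column \<open>i * k + b\<close> of the controllability matrix is column \<open>b\<close>
  of A^i B, so its left kernel only sees powers below \<open>n\<close>;
  \<open>krylov_kernel_stabilizes\<close> adds the others. Without a bound on \<open>j\<close> the
  condition is clearly invariant under the transpose of \<open>A\<close>.\<close>

lemma transpose_ctrb_matrix_kernel:
  fixes A :: "'a :: field mat"
  assumes A: "A \<in> carrier_mat n n" and B: "B \<in> carrier_mat n k" and y: "y \<in> carrier_vec n"
  shows "transpose_mat (ctrb_matrix A B) *\<^sub>v y = 0\<^sub>v (k * n) \<longleftrightarrow>
    (\<forall>j. transpose_mat B *\<^sub>v krylov (transpose_mat A) j y = 0\<^sub>v k)"
proof -
  have ent: "(transpose_mat B *\<^sub>v krylov (transpose_mat A) i y) $ b = col (A ^\<^sub>m i * B) b \<bullet> y"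
    if b: "b < k" for i b
  proof -
    have "transpose_mat B *\<^sub>v krylov (transpose_mat A) i y = transpose_mat (A ^\<^sub>m i * B) *\<^sub>v y"
      using A B y
      by (simp add: transpose_pow_mult_vec[symmetric] transpose_mult[of _ n n _ k]
          assoc_mult_mat_vec[of _ k n _ n])
    then show ?thesis using b A B by simp
  qed
  have colc: "col (ctrb_matrix A B) j = col (A ^\<^sub>m (j div k) * B) (j mod k)" if "j < k * n" for j
  proof -
    \<comment> \<open>Division and remainder by \<open>k\<close> recover power and column only for
      positive \<open>k\<close>; with \<open>k = 0\<close> there are no columns at all.\<close>
    have "k > 0" using that by (cases k) auto
    then show ?thesis
      by (intro eq_vecI) (use that A B in \<open>auto simp: ctrb_matrix_def\<close>)
  qed
  have "transpose_mat (ctrb_matrix A B) *\<^sub>v y = 0\<^sub>v (k * n) \<longleftrightarrow>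
      (\<forall>j<k*n. col (A ^\<^sub>m (j div k) * B) (j mod k) \<bullet> y = 0)"
    using ctrb_matrix_carrier[OF A B] by (auto simp: vec_eq_iff colc[symmetric])
  also have "\<dots> \<longleftrightarrow> (\<forall>i<n. \<forall>b<k. col (A ^\<^sub>m i * B) b \<bullet> y = 0)"
  proof
    assume L: "\<forall>j<k*n. col (A ^\<^sub>m (j div k) * B) (j mod k) \<bullet> y = 0"
    show "\<forall>i<n. \<forall>b<k. col (A ^\<^sub>m i * B) b \<bullet> y = 0"
    proof (intro allI impI)
      fix i b assume ib: "i < n" "b < k"
      have "i * k + b < Suc i * k" using ib by simp
      also have "\<dots> \<le> n * k" using ib by (intro mult_le_mono1) auto
      finally have "i * k + b < k * n" by (simp add: mult.commute)
      from L[rule_format, OF this] ib show "col (A ^\<^sub>m i * B) b \<bullet> y = 0" by simp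
    qed
  next
    assume R: "\<forall>i<n. \<forall>b<k. col (A ^\<^sub>m i * B) b \<bullet> y = 0"
    show "\<forall>j<k*n. col (A ^\<^sub>m (j div k) * B) (j mod k) \<bullet> y = 0"
    proof (intro allI impI)
      fix j assume j: "j < k * n"
      then have k: "k > 0" by (cases k) auto
      show "col (A ^\<^sub>m (j div k) * B) (j mod k) \<bullet> y = 0"
        using R j k by (simp add: less_mult_imp_div_less mult.commute)
    qed
  qed
  also have "\<dots> \<longleftrightarrow> (\<forall>i<n. transpose_mat B *\<^sub>v krylov (transpose_mat A) i y = 0\<^sub>v k)"
    using B by (auto simp: vec_eq_iff ent simp del: index_mult_mat_vec)
  also have "\<dots> \<longleftrightarrow> (\<forall>i. transpose_mat B *\<^sub>v krylov (transpose_mat A) i y = 0\<^sub>v k)"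
    using krylov_kernel_stabilizes[of "transpose_mat A" n "transpose_mat B" k y] A B y by auto
  finally show ?thesis .
qed

lemma completely_controllable_iff:
  fixes A :: "'a :: field mat"
  assumes A: "A \<in> carrier_mat n n" and B: "B \<in> carrier_mat n k"
  shows "completely_controllable A B \<longleftrightarrow> (\<forall>y \<in> carrier_vec n.
    (\<forall>j. transpose_mat B *\<^sub>v krylov (transpose_mat A) j y = 0\<^sub>v k) \<longrightarrow> y = 0\<^sub>v n)"
  using vec_space.rank_eq_dim_iff_trivial_left_kernel[OF ctrb_matrix_carrier[OF A B]]
    transpose_ctrb_matrix_kernel[OF A B] A
  unfolding completely_controllable_def by auto

lemma rank_less_dim_iff_left_kernel:
  fixes M :: "'a :: field mat"
  assumes M: "M \<in> carrier_mat n nc"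
  shows "vec_space.rank n M < n \<longleftrightarrow>
    (\<exists>y \<in> carrier_vec n. y \<noteq> 0\<^sub>v n \<and> transpose_mat M *\<^sub>v y = 0\<^sub>v nc)"
  using vec_space.rank_eq_dim_iff_trivial_left_kernel[OF M] vec_space.rank_le_dim[OF M] by auto

text \<open>The Hautus test: the first \<open>n\<close> columns say that \<open>y\<close> is a left
  eigenvector or zero, the last \<open>k\<close> that the input does not reach it.\<close>

lemma transpose_pbh_matrix_kernel:
  fixes A :: "'a :: field mat"
  assumes A: "A \<in> carrier_mat n n" and B: "B \<in> carrier_mat n k" and y: "y \<in> carrier_vec n"
  shows "transpose_mat (pbh_matrix A B l) *\<^sub>v y = 0\<^sub>v (n + k) \<longleftrightarrow>
    transpose_mat A *\<^sub>v y = l \<cdot>\<^sub>v y \<and> transpose_mat B *\<^sub>v y = 0\<^sub>v k"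
proof -
  let ?P = "pbh_matrix A B l"
  have P: "?P \<in> carrier_mat n (n + k)" using A B by (simp add: pbh_matrix_def)
  have c1: "col ?P j \<bullet> y = l * y $ j - col A j \<bullet> y" if j: "j < n" for j
  proof -
    have "col ?P j = l \<cdot>\<^sub>v unit_vec n j - col A j"
      by (rule eq_vecI) (use A B j in \<open>auto simp: pbh_matrix_def\<close>)
    then show ?thesis using A y j
      by (simp add: minus_scalar_prod_distrib[of _ n] )
  qed
  have c2: "col ?P (n + j) = col B j" if j: "j < k" for j
    by (rule eq_vecI) (use A B j in \<open>auto simp: pbh_matrix_def\<close>)
  have "transpose_mat ?P *\<^sub>v y = 0\<^sub>v (n + k) \<longleftrightarrow> (\<forall>j<n+k. col ?P j \<bullet> y = 0)"
    using P by (auto simp: vec_eq_iff)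
  also have "\<dots> \<longleftrightarrow> (\<forall>j<n. col ?P j \<bullet> y = 0) \<and> (\<forall>j<k. col ?P (n + j) \<bullet> y = 0)"
  proof safe
    fix j assume h: "\<forall>j<n. col ?P j \<bullet> y = 0" "\<forall>j<k. col ?P (n + j) \<bullet> y = 0" "j < n + k"
    show "col ?P j \<bullet> y = 0"
      using h(1) h(2)[rule_format, of "j - n"] h(3) by (cases "j < n") auto
  qed auto
  also have "\<dots> \<longleftrightarrow> transpose_mat A *\<^sub>v y = l \<cdot>\<^sub>v y \<and> transpose_mat B *\<^sub>v y = 0\<^sub>v k"
    using A B y by (auto simp: c1 c2 vec_eq_iff)
  finally show ?thesis .
qed

section \<open>The Kalman decomposition\<close>

lemma char_poly_four_block_upper_triangular:
  fixes A :: "'a :: idom mat"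
  assumes A: "A \<in> carrier_mat p p" and B: "B \<in> carrier_mat p q" and D: "D \<in> carrier_mat q q"
  shows "char_poly (four_block_mat A B (0\<^sub>m q p) D) = char_poly A * char_poly D"
proof -
  have "char_poly_matrix (four_block_mat A B (0\<^sub>m q p) D) =
      four_block_mat (char_poly_matrix A) (map_mat (\<lambda>x. [:- x:]) B) (0\<^sub>m q p) (char_poly_matrix D)"
    by (rule eq_matI) (use A B D in \<open>auto simp: char_poly_matrix_def\<close>)
  then show ?thesis
    using det_four_block_mat_lower_left_zero[of "char_poly_matrix A" p
        "map_mat (\<lambda>x. [:- x:]) B" q _ "char_poly_matrix D"] A B D
    by (simp add: char_poly_def)
qed

lemma char_poly_four_block_lower_triangular:
  fixes A :: "'a :: idom mat"
  assumes A: "A \<in> carrier_mat p p" and C: "C \<in> carrier_mat q p" and D: "D \<in> carrier_mat q q"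
  shows "char_poly (four_block_mat A (0\<^sub>m p q) C D) = char_poly A * char_poly D"
proof -
  have "char_poly (four_block_mat A (0\<^sub>m p q) C D) =
      char_poly (transpose_mat (four_block_mat A (0\<^sub>m p q) C D))"
    by (rule char_poly_transpose_mat[symmetric]) (use A D in auto)
  also have "transpose_mat (four_block_mat A (0\<^sub>m p q) C D) =
      four_block_mat (transpose_mat A) (transpose_mat C) (0\<^sub>m q p) (transpose_mat D)"
    using transpose_four_block_mat[OF A zero_carrier_mat C D] by simp
  also have "char_poly \<dots> = char_poly (transpose_mat A) * char_poly (transpose_mat D)"
    by (rule char_poly_four_block_upper_triangular) (use A C D in auto)
  finally show ?thesis using char_poly_transpose_mat[OF A] char_poly_transpose_mat[OF D] by simp
qed

lemma mult_mat_zero_vec: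
  "M \<in> carrier_mat nr nc \<Longrightarrow> M *\<^sub>v 0\<^sub>v nc = (0\<^sub>v nr :: 'a :: semiring_0 vec)"
  by (auto simp: vec_eq_iff)

lemma eigenvalue_transpose:
  fixes A :: "'a :: field mat"
  assumes "A \<in> carrier_mat n n"
  shows "eigenvalue (transpose_mat A) l \<longleftrightarrow> eigenvalue A l"
  using assms by (simp add: eigenvalue_root_char_poly[of _ n])

lemma trivial_kernel_imp_inverse:
  fixes T :: "'a :: field mat"
  assumes T: "T \<in> carrier_mat n n"
    and ker: "\<And>x. x \<in> carrier_vec n \<Longrightarrow> T *\<^sub>v x = 0\<^sub>v n \<Longrightarrow> x = 0\<^sub>v n"
  obtains Ti where "Ti \<in> carrier_mat n n" "T * Ti = 1\<^sub>m n" "Ti * T = 1\<^sub>m n"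
proof -
  have "det T \<noteq> 0" using det_0_iff_vec_prod_zero_field[OF T] ker by blast
  from det_non_zero_imp_unit[OF T this, of "()"] show ?thesis
    using that by (auto simp: Units_def ring_mat_def)
qed

lemma invertible_matE:
  fixes T :: "'a :: semiring_1 mat"
  assumes T: "T \<in> carrier_mat n n" and inv: "invertible_mat T"
  obtains Ti where "Ti \<in> carrier_mat n n" "T * Ti = 1\<^sub>m n" "Ti * T = 1\<^sub>m n"
proof -
  from inv obtain Ti where Ti: "T * Ti = 1\<^sub>m (dim_row T)" "Ti * T = 1\<^sub>m (dim_row Ti)"
    unfolding invertible_mat_def inverts_mat_def by auto
  have "dim_col (T * Ti) = n" "dim_col (Ti * T) = dim_row Ti" using Ti T by auto
  then have "Ti \<in> carrier_mat n n" using T by auto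
  then show ?thesis using that Ti T by auto
qed

lemma row_mult_mat:
  fixes X :: "'a :: comm_semiring_0 mat"
  assumes "X \<in> carrier_mat m n" "Y \<in> carrier_mat n l" "i < m"
  shows "row (X * Y) i = transpose_mat Y *\<^sub>v row X i"
  by (rule eq_vecI) (use assms in \<open>auto intro!: comm_scalar_prod[of _ n]\<close>)

lemma transpose_four_block_mult_append:
  fixes A :: "'a :: comm_ring_1 mat"
  assumes "A \<in> carrier_mat p p" "B \<in> carrier_mat p q" "D \<in> carrier_mat q q"
    "a \<in> carrier_vec p" "b \<in> carrier_vec q"
  shows "transpose_mat (four_block_mat A B (0\<^sub>m q p) D) *\<^sub>v (a @\<^sub>v b) =
    (transpose_mat A *\<^sub>v a) @\<^sub>v (transpose_mat B *\<^sub>v a + transpose_mat D *\<^sub>v b)"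
proof -
  have "transpose_mat (four_block_mat A B (0\<^sub>m q p) D) =
      four_block_mat (transpose_mat A) (0\<^sub>m p q) (transpose_mat B) (transpose_mat D)"
    using assms transpose_four_block_mat[of A p p B q "0\<^sub>m q p" q D] by simp
  moreover have "0\<^sub>m p q *\<^sub>v b = 0\<^sub>v p" using assms by auto
  ultimately show ?thesis
    using assms four_block_mat_mult_vec[of "transpose_mat A" p p "0\<^sub>m p q" q "transpose_mat B" q
        "transpose_mat D" a b] by simp
qed

lemma transpose_append_zero_rows_mult_append:
  fixes B :: "'a :: comm_ring_1 mat"
  assumes B: "B \<in> carrier_mat p k" and a: "a \<in> carrier_vec p" and b: "b \<in> carrier_vec q"
  shows "transpose_mat (B @\<^sub>r 0\<^sub>m q k) *\<^sub>v (a @\<^sub>v b) = transpose_mat B *\<^sub>v a"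
proof (rule eq_vecI)
  fix j assume "j < dim_vec (transpose_mat B *\<^sub>v a)"
  then have j: "j < k" using B by simp
  have "col (B @\<^sub>r 0\<^sub>m q k) j = col B j @\<^sub>v 0\<^sub>v q"
    by (rule eq_vecI) (use B j in \<open>auto simp: append_rows_def\<close>)
  then have "col (B @\<^sub>r 0\<^sub>m q k) j \<bullet> (a @\<^sub>v b) = col B j \<bullet> a + 0\<^sub>v q \<bullet> b"
    using B a b j by (simp add: scalar_prod_append[of _ p _ q])
  then show "(transpose_mat (B @\<^sub>r 0\<^sub>m q k) *\<^sub>v (a @\<^sub>v b)) $ j = (transpose_mat B *\<^sub>v a) $ j"
    using B j b by (simp add: append_rows_def)
qed (use B in \<open>simp add: append_rows_def\<close>)

text \<open>Transposition makes the matrix block lower triangular, so the upper component evolves on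
  its own. The lower component can stay unspecified, because the transformed input matrix has zero
  rows there.\<close>

lemma krylov_four_block:
  fixes A :: "'a :: comm_ring_1 mat"
  assumes A: "A \<in> carrier_mat p p" "B \<in> carrier_mat p q" "D \<in> carrier_mat q q"
    "a \<in> carrier_vec p" "b \<in> carrier_vec q"
  shows "\<exists>c \<in> carrier_vec q. krylov (transpose_mat (four_block_mat A B (0\<^sub>m q p) D)) j (a @\<^sub>v b) =
    krylov (transpose_mat A) j a @\<^sub>v c"
proof (induction j)
  case (Suc j)
  then obtain c where c: "c \<in> carrier_vec q" and
    e: "krylov (transpose_mat (four_block_mat A B (0\<^sub>m q p) D)) j (a @\<^sub>v b) = krylov (transpose_mat A) j a @\<^sub>v c"
    by blast
  have k: "krylov (transpose_mat A) j a \<in> carrier_vec p" using krylov_carrier[of "transpose_mat A" p a] A by simp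
  show ?case
    by (rule bexI[of _ "transpose_mat B *\<^sub>v krylov (transpose_mat A) j a + transpose_mat D *\<^sub>v c"])
      (use A c k e transpose_four_block_mult_append[OF A(1-3) k c] in auto)
qed (use assms in auto)

section \<open>Existence of the Kalman decomposition\<close>

text \<open>The bottom rows of $T$ are chosen to span
  $W = \{y \mid \forall j.\; y^T A^j B = 0\}$: take an invertible $T$ with as many bottom rows
  in $W$ as possible; a vector of $W$ outside their span could replace one more row.\<close>

lemma invertible_mat_maximal_rows:
  fixes W :: "'a :: field vec set"
  shows "\<exists>T Ti r. r \<le> n \<and> T \<in> carrier_mat n n \<and> Ti \<in> carrier_mat n n \<and>
    T * Ti = 1\<^sub>m n \<and> Ti * T = 1\<^sub>m n \<and> (\<forall>i. r \<le> i \<longrightarrow> i < n \<longrightarrow> row T i \<in> W) \<and>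
    (\<forall>v \<in> W. v \<in> carrier_vec n \<longrightarrow> (\<forall>i<r. (transpose_mat Ti *\<^sub>v v) $ i = 0))"
proof -
  \<comment> \<open>\<open>d\<close> counts the bottom rows known to lie in \<open>W\<close>; it is
    bounded by \<open>n\<close>, so a greatest value exists.\<close>
  define Q where "Q d \<longleftrightarrow> d \<le> n \<and> (\<exists>T Ti :: 'a mat. T \<in> carrier_mat n n \<and> Ti \<in> carrier_mat n n \<and>
    T * Ti = 1\<^sub>m n \<and> Ti * T = 1\<^sub>m n \<and> (\<forall>i. n - d \<le> i \<longrightarrow> i < n \<longrightarrow> row T i \<in> W))" for d
  define d where "d = Greatest Q"
  have Q0: "Q 0" unfolding Q_def by (auto intro!: exI[of _ "1\<^sub>m n"])
  have Qle: "\<forall>d. Q d \<longrightarrow> d \<le> n" unfolding Q_def by simp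
  have Qd: "Q d" unfolding d_def using GreatestI_nat[of Q 0 n] Q0 Qle by blast
  have Qmax: "\<not> Q (Suc d)" using Greatest_le_nat[of Q "Suc d" n] Qle unfolding d_def by fastforce
  define r where "r = n - d"
  from Qd obtain T Ti where T: "T \<in> carrier_mat n n" and Ti: "Ti \<in> carrier_mat n n"
    and inv: "T * Ti = 1\<^sub>m n" "Ti * T = 1\<^sub>m n" and rows: "\<And>i. r \<le> i \<Longrightarrow> i < n \<Longrightarrow> row T i \<in> W"
    unfolding Q_def r_def by blast
  have "(transpose_mat Ti *\<^sub>v v) $ i = 0" if vW: "v \<in> W" and v: "v \<in> carrier_vec n" and i: "i < r" for v i
  proof (rule ccontr)
    \<comment> \<open>The coordinates of \<open>v\<close> with respect to the rows of
      \<open>T\<close>. A nonzero coordinate before \<open>r\<close> places \<open>v\<close> outside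
      the span of the bottom rows.\<close>
    define c where "c = transpose_mat Ti *\<^sub>v v"
    assume "(transpose_mat Ti *\<^sub>v v) $ i \<noteq> 0"
    then have ci: "c $ i \<noteq> 0" unfolding c_def .
    have c: "c \<in> carrier_vec n" unfolding c_def using Ti v by simp
    have "transpose_mat T *\<^sub>v c = transpose_mat (Ti * T) *\<^sub>v v"
      unfolding c_def using T Ti v by (simp add: transpose_mult[of _ n n _ n] assoc_mult_mat_vec[of _ n n _ n])
    then have vc: "v = transpose_mat T *\<^sub>v c" using inv v by simp
    have rn: "r \<le> n" unfolding r_def by simp
    \<comment> \<open>The new vector goes just above the rows in \<open>W\<close>, and the displaced
      row \<open>r - 1\<close> moves to position \<open>i\<close>, whose old row is dropped. For
      \<open>i = r - 1\<close> this is a plain replacement.\<close>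
    define T' where "T' = mat n n (\<lambda>(a,b). if a = r - 1 then v $ b else if a = i then T $$ (r - 1, b) else T $$ (a,b))"
    have T': "T' \<in> carrier_mat n n" unfolding T'_def by simp
    have row': "row T' a = (if a = r - 1 then v else if a = i then row T (r - 1) else row T a)" if "a < n" for a
      by (rule eq_vecI) (use that v T i rn in \<open>auto simp: T'_def\<close>)
    have "x = 0\<^sub>v n" if x: "x \<in> carrier_vec n" and T'x: "T' *\<^sub>v x = 0\<^sub>v n" for x
    proof -
      have z: "row T' a \<bullet> x = 0" if a: "a < n" for a
      proof -
        have "(T' *\<^sub>v x) $ a = 0" using T'x a by simp
        then show ?thesis using T' a by simp
      qed
      \<comment> \<open>Every row of \<open>T\<close> except row \<open>i\<close> survives in
        \<open>T'\<close>, so only entry \<open>i\<close> of \<open>T\<close> times \<open>x\<close>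
        can be nonzero. The row \<open>v\<close> then gives \<open>c $ i\<close> times this entry as
        zero.\<close>
      have za: "(T *\<^sub>v x) $ a = 0" if a: "a < n" "a \<noteq> i" for a
      proof (cases "a = r - 1")
        case True
        then show ?thesis using z[of i] row'[of i] i a rn T by auto
      next
        case False
        then show ?thesis using z[of a] row'[of a] a T by auto
      qed
      have "0 = v \<bullet> x" using z[of "r - 1"] row'[of "r - 1"] i rn by auto
      also have "\<dots> = c \<bullet> (T *\<^sub>v x)"
        unfolding vc using transpose_vec_mult_scalar[OF T x c] .
      also have "\<dots> = (\<Sum>a<n. c $ a * (T *\<^sub>v x) $ a)"
        using T by (simp add: scalar_prod_def atLeast0LessThan)
      also have "\<dots> = c $ i * (T *\<^sub>v x) $ i"
        using i rn za by (subst sum.remove[of _ i]) auto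
      finally have "(T *\<^sub>v x) $ i = 0" using ci by simp
      then have "T *\<^sub>v x = 0\<^sub>v n" using za T by (auto simp: vec_eq_iff simp del: index_mult_mat_vec)
      then have "(Ti * T) *\<^sub>v x = 0\<^sub>v n" using T Ti x mult_mat_zero_vec[OF Ti] by (simp add: assoc_mult_mat_vec[of _ n n _ n])
      then show ?thesis using inv x by simp
    qed
    from trivial_kernel_imp_inverse[OF T' this] obtain Ti' where
      Ti': "Ti' \<in> carrier_mat n n" "T' * Ti' = 1\<^sub>m n" "Ti' * T' = 1\<^sub>m n" by blast
    have "row T' a \<in> W" if a: "n - Suc d \<le> a" "a < n" for a
    proof (cases "a = r - 1")
      case True
      then show ?thesis using row'[of a] a vW by simp
    next
      case False
      then have "r \<le> a" using a r_def by linarith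
      then show ?thesis using row'[of a] a False i rows by auto
    qed
    moreover have "Suc d \<le> n" using i r_def by linarith
    ultimately have "Q (Suc d)" unfolding Q_def using T' Ti' by blast
    then show False using Qmax by simp
  qed
  then show ?thesis
    using T Ti inv rows by (intro exI[of _ T] exI[of _ Ti] exI[of _ r]) (simp add: r_def)
qed

text \<open>\<open>W\<close> is invariant under the transpose of \<open>A\<close> and its vectors
  have no coordinates before \<open>r\<close>; applied to the bottom rows of \<open>T\<close>, this
  gives the zero block. For controllability of the upper pair, a left vector that the pair cannot
  detect is padded with zeros and pulled back by \<open>T\<close>: it lands in \<open>W\<close>, so
  its first \<open>r\<close> coordinates vanish, and these are the vector itself.\<close>

lemma kalman_decomp_exists:
  fixes A B :: "'a :: field mat"
  assumes A: "A \<in> carrier_mat n n" and B: "B \<in> carrier_mat n k"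
  shows "\<exists>T A11 A12 A22 B1. kalman_decomp A B T A11 A12 A22 B1"
proof -
  define W where "W = {y \<in> carrier_vec n. \<forall>j. transpose_mat B *\<^sub>v krylov (transpose_mat A) j y = 0\<^sub>v k}"
  obtain T Ti r where rn: "r \<le> n" and T: "T \<in> carrier_mat n n" and Ti: "Ti \<in> carrier_mat n n"
    and inv: "T * Ti = 1\<^sub>m n" "Ti * T = 1\<^sub>m n"
    and rows: "\<And>i. r \<le> i \<Longrightarrow> i < n \<Longrightarrow> row T i \<in> W"
    and max: "\<And>v i. v \<in> W \<Longrightarrow> v \<in> carrier_vec n \<Longrightarrow> i < r \<Longrightarrow> (transpose_mat Ti *\<^sub>v v) $ i = 0"
    using invertible_mat_maximal_rows[of n W] by blast
  have Winv: "transpose_mat A *\<^sub>v y \<in> W" if "y \<in> W" for y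
  proof -
    have "krylov (transpose_mat A) j (transpose_mat A *\<^sub>v y) = krylov (transpose_mat A) (Suc j) y" for j
      by (simp only: funpow_Suc_right o_apply)
    then show ?thesis using that A unfolding W_def by (auto simp del: funpow.simps)
  qed
  define M where "M = T * A * Ti"
  have M: "M \<in> carrier_mat n n" unfolding M_def using T A Ti by simp
  have TA: "T * A = M * T"
    unfolding M_def using T A Ti inv by (simp add: assoc_mult_mat[of _ n n _ n _ n])
  \<comment> \<open>Row \<open>i\<close> of \<open>M\<close> lists the coordinates, in the rows of
    \<open>T\<close>, of the transpose of \<open>A\<close> applied to row \<open>i\<close> of
    \<open>T\<close>.\<close>
  have M0: "M $$ (i,j) = 0" if i: "r \<le> i" "i < n" and j: "j < r" for i j
  proof -
    have rc: "row T i \<in> carrier_vec n" using T i by simp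
    have "row M i = transpose_mat Ti *\<^sub>v (transpose_mat A *\<^sub>v row T i)"
      unfolding M_def using T A Ti i rc
      by (simp add: row_mult_mat[of _ n n _ n] transpose_mult[of _ n n _ n] assoc_mult_mat_vec[of _ n n _ n])
    then have "row M i $ j = 0"
      using max[OF Winv[OF rows[OF i]] _ j] A rc by simp
    then show ?thesis using M i j rn by simp
  qed
  have TB0: "(T * B) $$ (i,j) = 0" if i: "r \<le> i" "i < n" and j: "j < k" for i j
  proof -
    have "row (T * B) i = transpose_mat B *\<^sub>v krylov (transpose_mat A) 0 (row T i)"
      using row_mult_mat[OF T B i(2)] by simp
    also have "\<dots> = 0\<^sub>v k" using rows[OF i] unfolding W_def by blast
    finally have "row (T * B) i $ j = 0" using j by simp
    then show ?thesis using T B i j by simp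
  qed
  define A11 where "A11 = mat r r (\<lambda>(i,j). M $$ (i,j))"
  define A12 where "A12 = mat r (n - r) (\<lambda>(i,j). M $$ (i,j + r))"
  define A22 where "A22 = mat (n - r) (n - r) (\<lambda>(i,j). M $$ (i + r,j + r))"
  define B1 where "B1 = mat r k (\<lambda>(i,j). (T * B) $$ (i,j))"
  have cs: "A11 \<in> carrier_mat r r" "A12 \<in> carrier_mat r (n - r)" "A22 \<in> carrier_mat (n - r) (n - r)"
    "B1 \<in> carrier_mat r k"
    unfolding A11_def A12_def A22_def B1_def by auto
  have Meq: "M = four_block_mat A11 A12 (0\<^sub>m (n - r) r) A22"
    by (rule eq_matI) (use M M0 rn in \<open>auto simp: A11_def A12_def A22_def\<close>)
  have TBeq: "T * B = B1 @\<^sub>r 0\<^sub>m (n - r) k"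
    by (rule eq_matI) (use T B TB0 rn in \<open>auto simp: B1_def append_rows_def\<close>)
  have ctrl: "completely_controllable A11 B1"
    unfolding completely_controllable_iff[OF cs(1,4)]
  proof (intro ballI impI)
    fix z assume z: "z \<in> carrier_vec r"
      and zk: "\<forall>j. transpose_mat B1 *\<^sub>v krylov (transpose_mat A11) j z = 0\<^sub>v k"
    define z' where "z' = z @\<^sub>v 0\<^sub>v (n - r)"
    have z': "z' \<in> carrier_vec n" unfolding z'_def using append_carrier_vec[OF z zero_carrier_vec, of "n - r"] rn by simp
    define y where "y = transpose_mat T *\<^sub>v z'"
    have y: "y \<in> carrier_vec n" unfolding y_def using T z' by simp
    have kc: "krylov (transpose_mat M) j z' \<in> carrier_vec n" for j
      using krylov_carrier[of "transpose_mat M" n z'] M z' by simp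
    have ky: "krylov (transpose_mat A) j y = transpose_mat T *\<^sub>v krylov (transpose_mat M) j z'" for j
    proof (induction j)
      case (Suc j)
      have "transpose_mat A *\<^sub>v (transpose_mat T *\<^sub>v krylov (transpose_mat M) j z') =
          transpose_mat (T * A) *\<^sub>v krylov (transpose_mat M) j z'"
        using T A kc by (simp add: transpose_mult[of _ n n _ n] assoc_mult_mat_vec[of _ n n _ n])
      also have "\<dots> = transpose_mat T *\<^sub>v (transpose_mat M *\<^sub>v krylov (transpose_mat M) j z')"
        unfolding TA using T M kc by (simp add: transpose_mult[of _ n n _ n] assoc_mult_mat_vec[of _ n n _ n])
      finally show ?case using Suc by simp
    qed (simp add: y_def)
    have "transpose_mat B *\<^sub>v krylov (transpose_mat A) j y = 0\<^sub>v k" for j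
    proof -
      obtain c where c: "c \<in> carrier_vec (n - r)"
        and e: "krylov (transpose_mat M) j z' = krylov (transpose_mat A11) j z @\<^sub>v c"
        using krylov_four_block[OF cs(1-3) z, of "0\<^sub>v (n - r)" j] unfolding Meq z'_def by auto
      have k1: "krylov (transpose_mat A11) j z \<in> carrier_vec r"
        using krylov_carrier[of "transpose_mat A11" r z] cs z by simp
      have "transpose_mat B *\<^sub>v krylov (transpose_mat A) j y = transpose_mat (T * B) *\<^sub>v krylov (transpose_mat M) j z'"
        unfolding ky using T B kc by (simp add: transpose_mult[of _ n n _ k] assoc_mult_mat_vec[of _ k n _ n])
      also have "\<dots> = transpose_mat B1 *\<^sub>v krylov (transpose_mat A11) j z"
        unfolding TBeq e by (rule transpose_append_zero_rows_mult_append[OF cs(4) k1 c])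
      finally show ?thesis using zk by simp
    qed
    then have "y \<in> W" unfolding W_def using y by simp
    moreover have "transpose_mat Ti *\<^sub>v y = transpose_mat (T * Ti) *\<^sub>v z'"
      unfolding y_def using T Ti z' by (simp add: transpose_mult[of _ n n _ n] assoc_mult_mat_vec[of _ n n _ n])
    then have "transpose_mat Ti *\<^sub>v y = z'" using inv z' by simp
    ultimately have "z' $ i = 0" if "i < r" for i using max[of y i] y that by simp
    then show "z = 0\<^sub>v r" using z by (auto simp: z'_def vec_eq_iff)
  qed
  have "invertible_mat T"
    unfolding invertible_mat_def inverts_mat_def using T Ti inv by auto
  then have "kalman_decomp A B T A11 A12 A22 B1"
    unfolding kalman_decomp_def Let_def using A B T cs rn ctrl TA Meq TBeq by auto
  then show ?thesis by blast
qed

section \<open>Consequences of a given Kalman decomposition\<close>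

text \<open>Naming both block sizes with \<open>n = r + q\<close> keeps truncated subtraction out of
  the block computations.\<close>

lemma kalman_decompE:
  fixes A B :: "'a :: field mat"
  assumes kd: "kalman_decomp A B T A11 A12 A22 B1"
    and A: "A \<in> carrier_mat n n" and B: "B \<in> carrier_mat n k"
  obtains r q Ti where "n = r + q" "T \<in> carrier_mat n n" "Ti \<in> carrier_mat n n"
    "T * Ti = 1\<^sub>m n" "Ti * T = 1\<^sub>m n" "A11 \<in> carrier_mat r r" "A12 \<in> carrier_mat r q"
    "A22 \<in> carrier_mat q q" "B1 \<in> carrier_mat r k"
    "T * A = four_block_mat A11 A12 (0\<^sub>m q r) A22 * T" "T * B = B1 @\<^sub>r 0\<^sub>m q k"
    "completely_controllable A11 B1"
proof -
  from kd A B have T: "T \<in> carrier_mat n n" "invertible_mat T"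
    unfolding kalman_decomp_def Let_def by auto
  have dims: "dim_row A = n" "dim_col B = k" using A B by auto
  obtain Ti where Ti: "Ti \<in> carrier_mat n n" "T * Ti = 1\<^sub>m n" "Ti * T = 1\<^sub>m n"
    using invertible_matE[OF T] .
  note kd' = kd[unfolded kalman_decomp_def Let_def dims]
  then have "dim_row A11 \<le> n" by (elim conjE)
  then obtain q where n: "n = dim_row A11 + q" using le_Suc_ex by blast
  then have q: "n - dim_row A11 = q" by linarith
  show ?thesis
    by (rule that[of "dim_row A11" q Ti])
      (insert n Ti kd'[unfolded q], (elim conjE, assumption)+)
qed

text \<open>In the new coordinates the upper part of \<open>w\<close> is a left null vector of both
  \<open>A11\<close> and \<open>B1\<close>, so controllability forces it to vanish. The lower part
  is therefore nonzero and a left null vector of \<open>A22\<close>.\<close>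

lemma kalman_uncontrollable_zero_eigenvalue:
  fixes A B :: "'a :: field mat"
  assumes kd: "kalman_decomp A B T A11 A12 A22 B1"
    and A: "A \<in> carrier_mat n n" and B: "B \<in> carrier_mat n k"
    and w: "w \<in> carrier_vec n" "w \<noteq> 0\<^sub>v n"
    and Aw: "transpose_mat A *\<^sub>v w = 0\<^sub>v n" and Bw: "transpose_mat B *\<^sub>v w = 0\<^sub>v k"
  shows "poly (char_poly A22) 0 = 0"
proof -
  obtain r q Ti where n: "n = r + q" and T: "T \<in> carrier_mat n n" and Ti: "Ti \<in> carrier_mat n n"
    and inv: "T * Ti = 1\<^sub>m n" "Ti * T = 1\<^sub>m n"
    and cs: "A11 \<in> carrier_mat r r" "A12 \<in> carrier_mat r q" "A22 \<in> carrier_mat q q" "B1 \<in> carrier_mat r k"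
    and TA: "T * A = four_block_mat A11 A12 (0\<^sub>m q r) A22 * T" and TB: "T * B = B1 @\<^sub>r 0\<^sub>m q k"
    and ctrl: "completely_controllable A11 B1"
    by (rule kalman_decompE[OF kd A B])
  define M where "M = four_block_mat A11 A12 (0\<^sub>m q r) A22"
  have M: "M \<in> carrier_mat n n" unfolding M_def n using cs by simp
  define y where "y = transpose_mat Ti *\<^sub>v w"
  have y: "y \<in> carrier_vec n" unfolding y_def using Ti w by simp
  have "transpose_mat T *\<^sub>v y = transpose_mat (Ti * T) *\<^sub>v w"
    unfolding y_def using T Ti w by (simp add: transpose_mult[of _ n n _ n] assoc_mult_mat_vec[of _ n n _ n])
  then have Ty: "transpose_mat T *\<^sub>v y = w" using inv w by simp
  have "transpose_mat T *\<^sub>v (transpose_mat M *\<^sub>v y) = transpose_mat (T * A) *\<^sub>v y"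
    unfolding TA M_def[symmetric] using T M y
    by (simp add: transpose_mult[of _ n n _ n] assoc_mult_mat_vec[of _ n n _ n])
  also have "\<dots> = 0\<^sub>v n"
    using T A y Ty Aw by (simp add: transpose_mult[of _ n n _ n] assoc_mult_mat_vec[of _ n n _ n])
  finally have z: "transpose_mat T *\<^sub>v (transpose_mat M *\<^sub>v y) = 0\<^sub>v n" .
  have "transpose_mat M *\<^sub>v y = transpose_mat (T * Ti) *\<^sub>v (transpose_mat M *\<^sub>v y)"
    using inv M y by simp
  also have "\<dots> = transpose_mat Ti *\<^sub>v (transpose_mat T *\<^sub>v (transpose_mat M *\<^sub>v y))"
    using T Ti M y by (simp add: transpose_mult[of _ n n _ n] assoc_mult_mat_vec[of _ n n _ n])
  also have "\<dots> = 0\<^sub>v n" unfolding z using Ti by (auto simp: vec_eq_iff)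
  finally have My: "transpose_mat M *\<^sub>v y = 0\<^sub>v n" .
  define y1 where "y1 = vec_first y r"
  define y2 where "y2 = vec_last y q"
  have yy: "y = y1 @\<^sub>v y2" "y1 \<in> carrier_vec r" "y2 \<in> carrier_vec q"
    unfolding y1_def y2_def using y n by auto
  have zero_append: "0\<^sub>v (r + q) = 0\<^sub>v r @\<^sub>v (0\<^sub>v q :: 'a vec)" by auto
  have "(transpose_mat A11 *\<^sub>v y1) @\<^sub>v (transpose_mat A12 *\<^sub>v y1 + transpose_mat A22 *\<^sub>v y2) = 0\<^sub>v r @\<^sub>v 0\<^sub>v q"
    using My transpose_four_block_mult_append[OF cs(1-3) yy(2,3)] unfolding yy(1) M_def n
    by (simp add: zero_append[symmetric])
  then have z1: "transpose_mat A11 *\<^sub>v y1 = 0\<^sub>v r"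
    and z2: "transpose_mat A12 *\<^sub>v y1 + transpose_mat A22 *\<^sub>v y2 = 0\<^sub>v q"
    using append_vec_eq[of "transpose_mat A11 *\<^sub>v y1" r "0\<^sub>v r"] cs yy by auto
  have "transpose_mat B1 *\<^sub>v y1 = transpose_mat (T * B) *\<^sub>v y"
    unfolding TB yy(1) by (rule transpose_append_zero_rows_mult_append[OF cs(4) yy(2,3), symmetric])
  also have "\<dots> = 0\<^sub>v k"
    using T B y Ty Bw by (simp add: transpose_mult[of _ n n _ k] assoc_mult_mat_vec[of _ k n _ n])
  finally have b1: "transpose_mat B1 *\<^sub>v y1 = 0\<^sub>v k" .
  \<comment> \<open>The orbit is zero after its first vector, so only the power 0 has to be checked
    against \<open>B1\<close>.\<close>
  have "krylov (transpose_mat A11) (Suc j) y1 = 0\<^sub>v r" for j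
    by (induction j) (use z1 cs in auto)
  then have "transpose_mat B1 *\<^sub>v krylov (transpose_mat A11) j y1 = 0\<^sub>v k" for j
    using b1 cs by (cases j) auto
  then have y1: "y1 = 0\<^sub>v r"
    using ctrl yy unfolding completely_controllable_iff[OF cs(1,4)] by blast
  have "y2 \<noteq> 0\<^sub>v q"
  proof
    assume "y2 = 0\<^sub>v q"
    then have "y = 0\<^sub>v n" using yy y1 n by auto
    then show False using Ty T w mult_mat_zero_vec[of "transpose_mat T" n n] by simp
  qed
  moreover have "transpose_mat A22 *\<^sub>v y2 = 0 \<cdot>\<^sub>v y2"
    using z2 y1 mult_mat_zero_vec[of "transpose_mat A12" q r] cs yy(3) by auto
  ultimately have "eigenvector (transpose_mat A22) y2 0"
    unfolding eigenvector_def using cs yy by auto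
  then have "eigenvalue A22 0"
    using eigenvalue_transpose[OF cs(3)] unfolding eigenvalue_def by blast
  then show ?thesis using eigenvalue_root_char_poly[OF cs(3)] by simp
qed

text \<open>The lower rows of \<open>T * B\<close> are zero, so feedback alters only the upper block
  row of the transformed matrix. The result is still block triangular with \<open>A22\<close> in the
  corner.\<close>

lemma kalman_char_poly_dvd_closed_loop:
  fixes A B K :: "'a :: field mat"
  assumes kd: "kalman_decomp A B T A11 A12 A22 B1"
    and A: "A \<in> carrier_mat n n" and B: "B \<in> carrier_mat n k" and K: "K \<in> carrier_mat k n"
  shows "char_poly A22 dvd char_poly (A - B * K)"
proof -
  obtain r q Ti where n: "n = r + q" and T: "T \<in> carrier_mat n n" and Ti: "Ti \<in> carrier_mat n n"
    and inv: "T * Ti = 1\<^sub>m n" "Ti * T = 1\<^sub>m n"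
    and cs: "A11 \<in> carrier_mat r r" "A12 \<in> carrier_mat r q" "A22 \<in> carrier_mat q q" "B1 \<in> carrier_mat r k"
    and TA: "T * A = four_block_mat A11 A12 (0\<^sub>m q r) A22 * T" and TB: "T * B = B1 @\<^sub>r 0\<^sub>m q k"
    and "completely_controllable A11 B1"
    by (rule kalman_decompE[OF kd A B])
  define M where "M = four_block_mat A11 A12 (0\<^sub>m q r) A22"
  have M: "M \<in> carrier_mat n n" unfolding M_def n using cs by simp
  \<comment> \<open>The feedback matrix in the new coordinates.\<close>
  define L where "L = K * Ti"
  have L: "L \<in> carrier_mat k n" unfolding L_def using K Ti by simp
  have TBc: "T * B \<in> carrier_mat n k" using T B by simp
  define C where "C = M - T * B * L"
  have C: "C \<in> carrier_mat n n" unfolding C_def by (rule minus_carrier_mat[OF mult_carrier_mat[OF TBc L]])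
  have LT: "L * T = K" unfolding L_def using K T Ti inv by (simp add: assoc_mult_mat[of _ k n _ n _ n])
  have "C * T = M * T - T * B * L * T"
    unfolding C_def using M TBc L T by (intro minus_mult_distrib_mat) auto
  also have "T * B * L * T = T * (B * K)"
    using T B L LT K by (simp add: assoc_mult_mat[of _ n n _ k _ n] assoc_mult_mat[of _ n k _ n _ n]
        assoc_mult_mat[of _ n n _ n _ n])
  also have "M * T = T * A" using TA M_def by simp
  also have "T * A - T * (B * K) = T * (A - B * K)"
    using T A B K by (intro mult_minus_distrib_mat[symmetric]) auto
  finally have CT: "C * T = T * (A - B * K)" .
  have AK: "A - B * K \<in> carrier_mat n n" using A B K by auto
  have "A - B * K = Ti * (T * (A - B * K))"
    using T Ti AK inv left_mult_one_mat[OF AK] by (simp add: assoc_mult_mat[of _ n n _ n _ n, symmetric])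
  then have "A - B * K = Ti * C * T" unfolding CT[symmetric]
    using T Ti C by (simp add: assoc_mult_mat[of _ n n _ n _ n])
  then have "similar_mat (A - B * K) C"
    unfolding similar_mat_def similar_mat_wit_def Let_def
    using T Ti C AK inv by (intro exI[of _ Ti] exI[of _ T]) auto
  then have "char_poly (A - B * K) = char_poly C" by (rule char_poly_similar)
  also have "C = four_block_mat (mat r r (\<lambda>(i,j). C $$ (i,j))) (mat r q (\<lambda>(i,j). C $$ (i,j + r))) (0\<^sub>m q r) A22"
  proof (rule eq_matI)
    fix i j
    assume "i < dim_row (four_block_mat (mat r r (\<lambda>(i,j). C $$ (i,j))) (mat r q (\<lambda>(i,j). C $$ (i,j + r))) (0\<^sub>m q r) A22)"
      and "j < dim_col (four_block_mat (mat r r (\<lambda>(i,j). C $$ (i,j))) (mat r q (\<lambda>(i,j). C $$ (i,j + r))) (0\<^sub>m q r) A22)"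
    then have ij: "i < n" "j < n" using cs n by auto
    have "C $$ (i,j) = M $$ (i,j)" if i: "r \<le> i"
    proof -
      have "row (T * B) i = 0\<^sub>v k"
        unfolding TB by (rule eq_vecI) (use cs i ij n in \<open>auto simp: append_rows_def\<close>)
      moreover have "(T * B * L) $$ (i,j) = row (T * B) i \<bullet> col L j"
        by (rule index_mult_mat(1)) (use T L ij in auto)
      ultimately have "(T * B * L) $$ (i,j) = 0" using L ij by simp
      moreover have "(M - T * B * L) $$ (i,j) = M $$ (i,j) - (T * B * L) $$ (i,j)"
        by (rule index_minus_mat(1)) (use T L ij in auto)
      ultimately show ?thesis unfolding C_def by simp
    qed
    then show "C $$ (i,j) = four_block_mat (mat r r (\<lambda>(i,j). C $$ (i,j))) (mat r q (\<lambda>(i,j). C $$ (i,j + r))) (0\<^sub>m q r) A22 $$ (i,j)"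
      using cs ij n by (auto simp: M_def)
  qed (use C cs n in auto)
  also have "char_poly \<dots> = char_poly (mat r r (\<lambda>(i,j). C $$ (i,j))) * char_poly A22"
    by (rule char_poly_four_block_upper_triangular) (use cs in auto)
  finally show ?thesis by simp
qed

section \<open>The opened ring\<close>

text \<open>The residue of i - d modulo \<open>m\<close> for \<open>i < m\<close> and
  \<open>d \<le> m\<close>, by cases to stay within linear arithmetic. Step 1 leads from a spacing,
  and step 2 from a velocity, to the velocity of the vehicle ahead.\<close>

definition cyc_pred :: "nat \<Rightarrow> nat \<Rightarrow> nat \<Rightarrow> nat" where
  "cyc_pred m d i = (if d \<le> i then i - d else i + m - d)"

text \<open>The blocks for both kinds of vehicles have the same first rows, so \<open>S\<close> only
  affects odd rows. The vehicle of the 0-based row \<open>i\<close> has the 1-based number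
  \<open>Suc (i div 2)\<close>.\<close>

lemma mixed_A_index:
  assumes n: "n \<ge> 2" and i: "i < 2*n" and j: "j < 2*n"
  shows "mixed_A n S a1 a2 a3 $$ (i,j) =
    (if even i then (if j = Suc i then -1 else if j = cyc_pred (2*n) 1 i then 1 else 0)
     else if Suc (i div 2) \<in> S then 0
     else if Suc j = i then a1 else if j = i then -a2 else if j = cyc_pred (2*n) 2 i then a3 else 0)"
proof -
  define a e where "a = i div 2" and "e = i mod 2"
  define b f where "b = j div 2" and "f = j mod 2"
  have i2: "i = 2*a + e" "e = 0 \<or> e = 1" and j2: "j = 2*b + f" "f = 0 \<or> f = 1"
    unfolding a_def e_def b_def f_def by auto
  have ab: "a < n" "b < n" using i j i2 j2 by auto
  have *: "mixed_A n S a1 a2 a3 $$ (i,j) =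
      (if b = a then (if Suc a \<in> S then blkC1 else blkA1 a1 a2) $$ (e, f)
       else if Suc b = (if a = 0 then n else a) then (if Suc a \<in> S then blkC2 else blkA2 a3) $$ (e, f)
       else 0)"
    unfolding mixed_A_def using i j by (simp add: Let_def a_def b_def e_def f_def)
  have blks: "blkA1 a1 a2 $$ (0,0) = 0" "blkA1 a1 a2 $$ (0,1) = -1" "blkA1 a1 a2 $$ (1,0) = a1" "blkA1 a1 a2 $$ (1,1) = -a2"
    "blkA2 a3 $$ (0,0) = 0" "blkA2 a3 $$ (0,1) = 1" "blkA2 a3 $$ (1,0) = 0" "blkA2 a3 $$ (1,1) = a3"
    "blkC1 $$ (0,0) = 0" "blkC1 $$ (0,1) = -1" "blkC1 $$ (1,0) = 0" "blkC1 $$ (1,1) = 0"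
    "blkC2 $$ (0,0) = 0" "blkC2 $$ (0,1) = 1" "blkC2 $$ (1,0) = 0" "blkC2 $$ (1,1) = 0"
    by (auto simp: blkA1_def blkA2_def blkC1_def blkC2_def mat_of_rows_list_def)
  have *: "mixed_A n S a1 a2 a3 $$ (2*a+e,2*b+f) =
      (if b = a then (if e = 0 then (if f = 0 then 0 else -1)
          else if Suc a \<in> S then 0 else if f = 0 then a1 else -a2)
       else if Suc b = (if a = 0 then n else a) then
         (if f = 0 then 0 else if e = 0 then 1 else if Suc a \<in> S then 0 else a3)
       else 0)"
    using * i2 j2 by (auto simp: blks blks[unfolded One_nat_def])
  have par: "even (2*a+e) \<longleftrightarrow> e = 0" "(2*a+e) div 2 = a" using i2 by auto
  have eqs: "e = 0 \<Longrightarrow> 2*b+f = Suc (2*a+e) \<longleftrightarrow> b = a \<and> f = 1"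
    "e = 0 \<Longrightarrow> 2*b+f = cyc_pred (2*n) 1 (2*a+e) \<longleftrightarrow> Suc b = (if a = 0 then n else a) \<and> f = 1"
    "e = 1 \<Longrightarrow> Suc (2*b+f) = 2*a+e \<longleftrightarrow> b = a \<and> f = 0"
    "e = 1 \<Longrightarrow> 2*b+f = 2*a+e \<longleftrightarrow> b = a \<and> f = 1"
    "e = 1 \<Longrightarrow> 2*b+f = cyc_pred (2*n) 2 (2*a+e) \<longleftrightarrow> Suc b = (if a = 0 then n else a) \<and> f = 1"
    subgoal using j2(2) by auto arith+
    subgoal using j2(2) ab n unfolding cyc_pred_def by (cases "a = 0") (elim disjE; simp; arith)+
    subgoal using j2(2) by auto arith+
    subgoal using j2(2) by auto arith+
    subgoal using j2(2) ab n unfolding cyc_pred_def by (cases "a = 0") (elim disjE; simp; arith)+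
    done
  show ?thesis
    unfolding i2(1) j2(1) * par using i2(2) j2(2) eqs n
    by (cases "e = 0") auto
qed

text \<open>The closed loop: the AV whose velocity has index $c$ uses $u = -\tilde v$, which opens
  the ring at this vehicle; every other AV imitates a human driver.\<close>

definition opened_ring :: "nat \<Rightarrow> nat \<Rightarrow> real \<Rightarrow> real \<Rightarrow> real \<Rightarrow> real mat" where
  "opened_ring n c a1 a2 a3 = mat (2*n) (2*n) (\<lambda>(i,j).
    if even i then (if j = Suc i then -1 else if j = cyc_pred (2*n) 1 i then 1 else 0)
    else if i = c then (if j = c then -1 else 0)
    else if Suc j = i then a1 else if j = i then -a2 else if j = cyc_pred (2*n) 2 i then a3 else 0)"

lemma opened_ring_carrier: "opened_ring n c a1 a2 a3 \<in> carrier_mat (2*n) (2*n)"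
  by (simp add: opened_ring_def)

lemma mixed_A_carrier: "mixed_A n S a1 a2 a3 \<in> carrier_mat (2*n) (2*n)"
  by (simp add: mixed_A_def)

lemma mixed_B_carrier: "mixed_B n S \<in> carrier_mat (2*n) (card S)"
  by (simp add: mixed_B_def)

text \<open>The two matrices differ only in velocity rows of AVs, and the columns of
  \<open>mixed_B\<close> are the unit vectors of exactly these rows. Hence the rows of
  \<open>K\<close> can be read off from the difference.\<close>

lemma exists_opening_feedback:
  assumes n: "n \<ge> 2" and S: "S \<subseteq> {1..n}" and s: "s \<in> S"
  shows "\<exists>K \<in> carrier_mat (card S) (2*n).
    mixed_A n S a1 a2 a3 - mixed_B n S * K = opened_ring n (2*s - 1) a1 a2 a3"
proof -
  let ?A = "mixed_A n S a1 a2 a3" and ?B = "mixed_B n S" and ?R = "opened_ring n (2*s - 1) a1 a2 a3"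
  let ?l = "sorted_list_of_set S"
  have fin: "finite S" using S finite_subset by blast
  have l: "distinct ?l" "set ?l = S" "length ?l = card S" using fin by auto
  define K where "K = mat (card S) (2*n) (\<lambda>(r,j). (?A - ?R) $$ (2 * (?l ! r) - 1, j))"
  have K: "K \<in> carrier_mat (card S) (2*n)" unfolding K_def by simp
  have "(?B * K) $$ (i,j) = (?A - ?R) $$ (i,j)" if ij: "i < 2*n" "j < 2*n" for i j
  proof -
    have "(?B * K) $$ (i,j) = (\<Sum>r<card S. ?B $$ (i,r) * K $$ (r,j))"
      using ij K mixed_B_carrier[of n S] by (auto simp: scalar_prod_def atLeast0LessThan intro!: sum.cong)
    also have "\<dots> = (\<Sum>r<card S. if i + 1 = 2 * (?l ! r) then (?A - ?R) $$ (i,j) else 0)"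
    proof (rule sum.cong[OF refl])
      fix r assume "r \<in> {..<card S}"
      moreover have "2 * (?l ! r) - 1 = i" if "i + 1 = 2 * (?l ! r)" using that by simp
      ultimately show "?B $$ (i,r) * K $$ (r,j) = (if i + 1 = 2 * (?l ! r) then (?A - ?R) $$ (i,j) else 0)"
        using ij unfolding mixed_B_def K_def by auto
    qed
    also have "\<dots> = (?A - ?R) $$ (i,j)"
    \<comment> \<open>In the velocity row of an AV exactly one column of the input matrix is
      nonzero; in every other row none is, and the difference must vanish there.\<close>
    proof (cases "odd i \<and> Suc (i div 2) \<in> S")
      case True
      then obtain r0 where r0: "r0 < card S" "?l ! r0 = Suc (i div 2)"
        using l by (metis in_set_conv_nth)
      have "i + 1 = 2 * (?l ! r) \<longleftrightarrow> r = r0" if "r < card S" for r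
      proof -
        have "odd i" using True by simp
        then have "i + 1 = 2 * q \<longleftrightarrow> q = Suc (i div 2)" for q by presburger
        then have "i + 1 = 2 * (?l ! r) \<longleftrightarrow> ?l ! r = ?l ! r0" using r0 by simp
        then show ?thesis using nth_eq_iff_index_eq[OF l(1), of r r0] that r0(1) l(3) by simp
      qed
      then have "(\<Sum>r<card S. if i + 1 = 2 * (?l ! r) then (?A - ?R) $$ (i,j) else 0) =
          (\<Sum>r<card S. if r = r0 then (?A - ?R) $$ (i,j) else 0)"
        by (intro sum.cong) auto
      then show ?thesis using r0 by simp
    next
      case False
      have "i + 1 \<noteq> 2 * (?l ! r)" if "r < card S" for r
      proof
        assume e: "i + 1 = 2 * (?l ! r)"
        have "?l ! r \<in> S" using that l by (metis nth_mem)
        moreover have "odd i" "Suc (i div 2) = ?l ! r" using e by presburger+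
        ultimately show False using False by simp
      qed
      then have "(\<Sum>r<card S. if i + 1 = 2 * (?l ! r) then (?A - ?R) $$ (i,j) else 0) = 0" by simp
      \<comment> \<open>The exceptional row of the opened ring belongs to an AV, so it is not met in
        this case.\<close>
      moreover have "i \<noteq> 2 * s - 1" if "odd i"
      proof
        assume e: "i = 2 * s - 1"
        have "s \<ge> 1" using S s by auto
        then have "Suc (i div 2) = s" using e by presburger
        then show False using False s that by simp
      qed
      then have "(?A - ?R) $$ (i,j) = 0"
        using False ij mixed_A_index[OF n ij, of S a1 a2 a3] mixed_A_carrier[of n S a1 a2 a3]
        by (auto simp: opened_ring_def)
      ultimately show ?thesis by simp
    qed
    finally show ?thesis .
  qed
  then have BK: "?B * K = ?A - ?R"
    using K mixed_B_carrier[of n S] opened_ring_carrier[of n "2*s-1" a1 a2 a3]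
    by (intro eq_matI) (auto simp del: index_mult_mat(1) index_minus_mat(1))
  have "?A - ?B * K = ?R"
    unfolding BK using mixed_A_carrier[of n S a1 a2 a3] opened_ring_carrier[of n "2*s-1" a1 a2 a3]
    by (intro eq_matI) auto
  then show ?thesis using K by blast
qed

section \<open>Characteristic polynomial of the opened ring\<close>

text \<open>Rows and columns each contribute the sign of \<open>p\<close>, and its square is 1.
  Columns are permuted as rows of the transpose.\<close>

lemma char_poly_permute:
  fixes A :: "'a :: comm_ring_1 mat"
  assumes A: "A \<in> carrier_mat m m" and p: "p permutes {0..<m}"
  shows "char_poly (mat m m (\<lambda>(i,j). A $$ (p i, p j))) = char_poly A"
proof -
  let ?M = "char_poly_matrix A"
  have M: "?M \<in> carrier_mat m m" using A by simp
  have pm: "p i < m \<longleftrightarrow> i < m" for i using permutes_in_image[OF p, of i] by simp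
  have pe: "p i = p j \<longleftrightarrow> i = j" for i j using permutes_inj[OF p] by (auto simp: inj_def)
  define N where "N = mat m m (\<lambda>(i,j). ?M $$ (p i, j))"
  have "char_poly_matrix (mat m m (\<lambda>(i,j). A $$ (p i, p j))) =
      transpose_mat (mat m m (\<lambda>(i,j). transpose_mat N $$ (p i, j)))"
    by (rule eq_matI) (use A pm pe in \<open>auto simp: char_poly_matrix_def N_def\<close>)
  then have "char_poly (mat m m (\<lambda>(i,j). A $$ (p i, p j))) =
      det (transpose_mat (mat m m (\<lambda>(i,j). transpose_mat N $$ (p i, j))))"
    by (simp add: char_poly_def)
  also have "\<dots> = det (mat m m (\<lambda>(i,j). transpose_mat N $$ (p i, j)))"
    by (rule det_transpose[of _ m]) simp
  also have "\<dots> = signof p * det (transpose_mat N)"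
    by (rule det_permute_rows[OF _ p]) (simp add: N_def)
  also have "det (transpose_mat N) = det N" by (rule det_transpose[of _ m]) (simp add: N_def)
  also have "det N = signof p * det ?M"
    unfolding N_def by (rule det_permute_rows[OF M p])
  also have "signof p * (signof p * det ?M) = char_poly A"
    by (simp add: char_poly_def sign_def)
  finally show ?thesis .
qed

lemma det_2x2:
  assumes A: "A \<in> carrier_mat 2 2"
  shows "det A = A $$ (0,0) * A $$ (1,1) - A $$ (0,1) * A $$ (1,0)"
proof -
  have "det (mat_delete A 0 j) = mat_delete A 0 j $$ (0,0)" if "j < 2" for j
    by (rule det_single) (use A that in \<open>auto simp: mat_delete_def\<close>)
  then show ?thesis
    using A by (subst laplace_expansion_row[OF A, of 0])
      (auto simp: cofactor_def mat_delete_def numeral_2_eq_2)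
qed

text \<open>The opened ring cut behind its AV: index 0 is the velocity of that AV, odd indices are
  spacings and positive even ones velocities of the vehicles following it. Entries do not depend on
  the size, so a chain is a leading block of every longer one.\<close>

fun chain_entry :: "'a \<Rightarrow> 'a \<Rightarrow> 'a \<Rightarrow> nat \<times> nat \<Rightarrow> 'a :: comm_ring_1" where
  "chain_entry a1 a2 a3 (i,j) =
    (if i = 0 then (if j = 0 then -1 else 0)
     else if odd i then (if j = Suc i then -1 else if Suc j = i then 1 else 0)
     else if Suc j = i then a1 else if j = i then -a2 else if j + 2 = i then a3 else 0)"

text \<open>A vehicle depends only on itself and the one ahead, so a vehicle appended at the end
  adds one diagonal block, with rows (0, -1) and (a1, -a2). The coupling to the vehicle ahead lies
  in the block \<open>?C\<close> below the diagonal.\<close>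

lemma char_poly_chain:
  fixes a1 a2 a3 :: "'a :: idom"
  shows "char_poly (mat (2*m+1) (2*m+1) (chain_entry a1 a2 a3)) = [:1, 1:] * [:a1, a2, 1:] ^ m"
proof (induction m)
  case 0
  show ?case by (subst char_poly_upper_triangular[of _ 1]) (auto simp: diag_mat_def)
next
  case (Suc m)
  let ?C = "mat 2 (2*m+1) (\<lambda>(i,j). chain_entry a1 a2 a3 (i + (2*m+1), j))"
  let ?D = "mat 2 2 (\<lambda>(i,j). chain_entry a1 a2 a3 (i + (2*m+1), j + (2*m+1)))"
  have eq: "mat (2*Suc m+1) (2*Suc m+1) (chain_entry a1 a2 a3) =
      four_block_mat (mat (2*m+1) (2*m+1) (chain_entry a1 a2 a3)) (0\<^sub>m (2*m+1) 2) ?C ?D"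
    by (rule eq_matI) (auto simp: less_Suc_eq)
  have "char_poly ?D = [:a1, a2, 1:]"
    by (subst char_poly_def, subst det_2x2) (auto simp: char_poly_matrix_def)
  moreover have "char_poly (four_block_mat (mat (2*m+1) (2*m+1) (chain_entry a1 a2 a3)) (0\<^sub>m (2*m+1) 2) ?C ?D) =
      char_poly (mat (2*m+1) (2*m+1) (chain_entry a1 a2 a3)) * char_poly ?D"
    by (rule char_poly_four_block_lower_triangular) auto
  ultimately show ?case unfolding eq Suc power_Suc by (simp only: mult_ac)
qed

text \<open>The last index in the rotated order is the spacing of the opening AV. Its column is
  zero, because only the replaced velocity row used this spacing; this gives the factor X, and the
  remaining rows and columns form a chain.\<close>

lemma char_poly_opened_ring:
  assumes n: "n \<ge> 2" and c: "odd c" "c < 2*n"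
  shows "char_poly (opened_ring n c a1 a2 a3) = [:0, 1:] * ([:1, 1:] * [:a1, a2, 1:] ^ (n - 1))"
proof -
  \<comment> \<open>Rotation by \<open>c\<close> sends 0 to the velocity of the opening AV and, as
    \<open>c\<close> is odd, exchanges the parities of spacings and velocities.\<close>
  define p where "p q = (if q < 2*n then (if q + c < 2*n then q + c else q + c - 2*n) else q)" for q
  have inj: "inj_on p {0..<2*n}"
    unfolding inj_on_def p_def by (auto split: if_splits)
  have img: "p ` {0..<2*n} \<subseteq> {0..<2*n}"
    unfolding p_def using c by auto
  have "bij_betw p {0..<2*n} {0..<2*n}"
    using inj endo_inj_surj[OF _ img inj] by (simp add: bij_betw_def)
  then have perm: "p permutes {0..<2*n}"
    by (rule bij_imp_permutes) (simp add: p_def)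
  have pe: "p i = p j \<longleftrightarrow> i = j" for i j using permutes_inj[OF perm] by (auto simp: inj_def)
  \<comment> \<open>The only entry that closes the ring: the last row is the spacing of the opening
    AV, whose own velocity has index 0 instead of the next index.\<close>
  have entry: "opened_ring n c a1 a2 a3 $$ (p i, p j) =
      (if i = 2*n-1 \<and> j = 0 then -1 else chain_entry a1 a2 a3 (i,j))"
    if i: "i < 2*n" and j: "j < 2*n" for i j
  proof -
    have pi: "p i < 2*n" "p j < 2*n" using i j img by (auto simp: image_subset_iff)
    have par: "even (p i) \<longleftrightarrow> odd i" unfolding p_def using i c by auto
    have p0: "p 0 = c" unfolding p_def using c n by simp
    have pc: "p i = c \<longleftrightarrow> i = 0" using pe[of i 0] p0 by simp
    have pS: "Suc (p i) = p (if i = 2*n-1 then 0 else Suc i)" if "odd i"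
      unfolding p_def using i c that by auto presburger+
    have pP: "cyc_pred (2*n) 1 (p i) = p (i - 1)" if "i > 0"
      unfolding p_def cyc_pred_def using i c that by auto
    have pP2: "cyc_pred (2*n) 2 (p i) = p (i - 2)" if "i \<ge> 2"
      unfolding p_def cyc_pred_def using i c that by auto
    have pP1: "Suc (p j) = p i \<longleftrightarrow> Suc j = i" if "even i" "i > 0"
    proof -
      have "p i = Suc (p (i - 1))"
        unfolding p_def using i c that by auto presburger+
      then show ?thesis using pe[of j "i - 1"] that by auto
    qed
    show ?thesis
    proof (cases "odd i")
      case True
      then have "i > 0" by (cases i) auto
      have "opened_ring n c a1 a2 a3 $$ (p i, p j) =
          (if p j = p (if i = 2*n-1 then 0 else Suc i) then -1 else if p j = p (i - 1) then 1 else 0)"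
        unfolding opened_ring_def using pi par True pS pP[OF \<open>i > 0\<close>] by simp
      then show ?thesis unfolding pe using True n j \<open>i > 0\<close> by auto
    next
      case False
      show ?thesis
      proof (cases "i = 0")
        case True
        then show ?thesis
          unfolding opened_ring_def using pi par p0 pe[of j 0] n c by auto
      next
        case i0: False
        then have i2: "i \<ge> 2" using False by presburger
        have "opened_ring n c a1 a2 a3 $$ (p i, p j) =
            (if Suc (p j) = p i then a1 else if p j = p i then -a2 else if p j = p (i - 2) then a3 else 0)"
          unfolding opened_ring_def using pi par False pc i0 pP2[OF i2] by simp
        moreover have "i \<noteq> 2*n - 1" using False n by presburger
        ultimately show ?thesis using pP1 pe False i0 i2 by auto
      qed
    qed
  qed
  define m where "m = n - 1"
  have nm: "2*n = (2*m+1) + 1" using n unfolding m_def by simp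
  let ?C = "mat 1 (2*m+1) (\<lambda>(i,j). if j = 0 then -1 else chain_entry a1 a2 a3 (2*m+1, j))"
  have "mat (2*n) (2*n) (\<lambda>(i,j). opened_ring n c a1 a2 a3 $$ (p i, p j)) =
      four_block_mat (mat (2*m+1) (2*m+1) (chain_entry a1 a2 a3)) (0\<^sub>m (2*m+1) 1) ?C (0\<^sub>m 1 1)"
    (is "?L = ?F")
  proof (rule eq_matI)
    fix i j assume "i < dim_row ?F" "j < dim_col ?F"
    then have ij: "i < 2*n" "j < 2*n" "i < 2*m+2" "j < 2*m+2" unfolding nm by auto
    have last: "2*n - 1 = 2*m+1" using nm by simp
    have L: "?L $$ (i,j) = (if i = 2*m+1 \<and> j = 0 then -1 else chain_entry a1 a2 a3 (i,j))"
      using entry[OF ij(1,2)] ij(1,2) unfolding last by simp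
    \<comment> \<open>Above the last row, an entry in the last column could only be the -1 of a
      spacing row, but the row before the last has an even index.\<close>
    have top: "chain_entry a1 a2 a3 (i,j) = 0" if "i < 2*m+1" "j = 2*m+1"
    proof -
      have "\<not> (odd i \<and> j = Suc i)" using that by presburger
      then show ?thesis using that by auto
    qed
    have corner: "chain_entry a1 a2 a3 (2*m+1, 2*m+1) = 0" by auto
    consider "i < 2*m+1" "j < 2*m+1" | "i < 2*m+1" "j = 2*m+1" | "i = 2*m+1" "j < 2*m+1" | "i = 2*m+1" "j = 2*m+1"
      using ij by linarith
    then show "?L $$ (i,j) = ?F $$ (i,j)"
      unfolding L by cases (use top corner in \<open>simp_all del: chain_entry.simps\<close>)
  qed (use nm in auto)
  then have "char_poly (opened_ring n c a1 a2 a3) =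
      char_poly (mat (2*m+1) (2*m+1) (chain_entry a1 a2 a3)) * char_poly (0\<^sub>m 1 1 :: real mat)"
    unfolding char_poly_permute[OF opened_ring_carrier perm, symmetric]
    by (simp only: char_poly_four_block_lower_triangular mat_carrier zero_carrier_mat)
  moreover have "char_poly (0\<^sub>m 1 1 :: real mat) = [:0, 1:]"
    by (subst char_poly_upper_triangular[of _ 1]) (auto simp: diag_mat_def)
  ultimately show ?thesis unfolding char_poly_chain m_def by (simp add: mult_ac)
qed

section \<open>Roots of the closed-loop polynomial\<close>

text \<open>The imaginary part of the equation factors as Im l (b + 2 Re l). Either the real part is
  -b/2, or the root is real, and at a real number that is not negative the polynomial is at least
  \<open>a\<close>.\<close>

lemma quadratic_root_Re_neg:
  fixes a b :: real and l :: complex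
  assumes a: "a > 0" and b: "b > 0" and root: "of_real a + l * (of_real b + l) = 0"
  shows "Re l < 0"
proof -
  have re: "a + (Re l * (b + Re l) - Im l * Im l) = 0" and im: "Re l * Im l + Im l * (b + Re l) = 0"
    using arg_cong[OF root, of Re] arg_cong[OF root, of Im] by simp_all
  from im have "Im l * (b + 2 * Re l) = 0" by (simp add: algebra_simps)
  then consider "Im l = 0" | "b + 2 * Re l = 0" by auto
  then show ?thesis
  proof cases
    case 1
    show ?thesis
    proof (rule ccontr)
      assume "\<not> Re l < 0"
      then have "Re l * (b + Re l) \<ge> 0" using b by simp
      then show False using re 1 a by simp
    qed
  qed (use b in simp)
qed

lemma eigenvalue_opened_ring:
  assumes n: "n \<ge> 2" and c: "odd c" "c < 2*n" and a: "a1 > 0" "a2 > 0"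
    and ev: "eigenvalue (map_mat complex_of_real (opened_ring n c a1 a2 a3)) l"
  shows "l = 0 \<or> Re l < 0"
proof -
  interpret h: map_poly_comm_ring_hom complex_of_real ..
  let ?p = "[:0, 1:] * ([:1, 1:] * [:a1, a2, 1:] ^ (n - 1)) :: real poly"
  have "poly (char_poly (map_mat complex_of_real (opened_ring n c a1 a2 a3))) l = 0"
    using ev eigenvalue_root_char_poly[of "map_mat complex_of_real (opened_ring n c a1 a2 a3)" "2*n"]
      opened_ring_carrier by simp
  also have "char_poly (map_mat complex_of_real (opened_ring n c a1 a2 a3)) = map_poly complex_of_real ?p"
    using of_real_hom.char_poly_hom[OF opened_ring_carrier] char_poly_opened_ring[OF n c] by metis
  finally have "l * ((1 + l) * (of_real a1 + l * (of_real a2 + l)) ^ (n - 1)) = 0"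
    by (simp add: h.hom_mult h.hom_power map_poly_pCons del: mult_pCons_left mult_pCons_right)
  then consider "l = 0" | "1 + l = 0" | "of_real a1 + l * (of_real a2 + l) = 0" by auto
  then show ?thesis
  proof cases
    case 2
    then have "l = - 1" by (simp add: eq_neg_iff_add_eq_0 add.commute)
    then show ?thesis by simp
  qed (use quadratic_root_Re_neg[OF a] in auto)
qed

text \<open>At 0 the cofactor of X has the value a1^(n-1).\<close>

lemma order_zero_opened_ring:
  assumes n: "n \<ge> 2" and c: "odd c" "c < 2*n" and a: "a1 \<noteq> 0"
  shows "Polynomial.order 0 (char_poly (opened_ring n c a1 a2 a3)) = 1"
proof -
  let ?q = "[:1, 1:] * [:a1, a2, 1:] ^ (n - 1)"
  have q: "poly ?q 0 \<noteq> 0" using a by simp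
  then have q0: "?q \<noteq> 0" by (metis poly_0)
  have "Polynomial.order 0 ([:0, 1:] * ?q) = Polynomial.order 0 [:0, 1::real:] + Polynomial.order 0 ?q"
    by (rule Polynomial.order_mult) (use q0 in simp)
  also have "Polynomial.order 0 ?q = 0" using q order_0I by blast
  also have "Polynomial.order 0 [:0, 1::real:] = 1" using order_power_n_n[of "0::real" 1] by simp
  finally show ?thesis unfolding char_poly_opened_ring[OF n c] by simp
qed

section \<open>The mixed traffic system\<close>

lemma kalman_uncontrollable_zero_order:
  fixes A B K :: "'a :: field mat"
  assumes kd: "kalman_decomp A B T A11 A12 A22 B1"
    and A: "A \<in> carrier_mat n n" and B: "B \<in> carrier_mat n k" and K: "K \<in> carrier_mat k n"
    and w: "w \<in> carrier_vec n" "w \<noteq> 0\<^sub>v n"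
    and Aw: "transpose_mat A *\<^sub>v w = 0\<^sub>v n" and Bw: "transpose_mat B *\<^sub>v w = 0\<^sub>v k"
    and simple: "Polynomial.order 0 (char_poly (A - B * K)) = 1"
  shows "Polynomial.order 0 (char_poly A22) = 1"
proof -
  obtain q where q: "char_poly (A - B * K) = char_poly A22 * q"
    using kalman_char_poly_dvd_closed_loop[OF kd A B K] by (elim dvdE)
  have "A - B * K \<in> carrier_mat n n" using A B K by auto
  \<comment> \<open>Characteristic polynomials are monic, hence nonzero, and orders of roots add
    over the factorization.\<close>
  then have "char_poly (A - B * K) \<noteq> 0" using degree_monic_char_poly[of "A - B * K" n] by auto
  then have nz: "char_poly A22 * q \<noteq> 0" "char_poly A22 \<noteq> 0" unfolding q by auto
  have "Polynomial.order 0 (char_poly A22) \<le> 1"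
    using simple Polynomial.order_mult[OF nz(1), of 0] unfolding q by simp
  moreover have "Polynomial.order 0 (char_poly A22) \<noteq> 0"
    using kalman_uncontrollable_zero_eigenvalue[OF kd A B w Aw Bw] nz(2) by (simp add: order_root)
  ultimately show ?thesis by linarith
qed

lemma pbh_deficient_imp_closed_loop_eigenvalue:
  fixes A B K :: "'a :: field mat"
  assumes A: "A \<in> carrier_mat n n" and B: "B \<in> carrier_mat n k" and K: "K \<in> carrier_mat k n"
    and rank: "vec_space.rank n (pbh_matrix A B l) < n"
  shows "eigenvalue (A - B * K) l"
proof -
  have P: "pbh_matrix A B l \<in> carrier_mat n (n + k)" using A B by (simp add: pbh_matrix_def)
  obtain y where y: "y \<in> carrier_vec n" "y \<noteq> 0\<^sub>v n"
    and Ay: "transpose_mat A *\<^sub>v y = l \<cdot>\<^sub>v y" and By: "transpose_mat B *\<^sub>v y = 0\<^sub>v k"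
    using rank transpose_pbh_matrix_kernel[OF A B] unfolding rank_less_dim_iff_left_kernel[OF P] by blast
  have AK: "A - B * K \<in> carrier_mat n n" using A B K by auto
  have "transpose_mat (A - B * K) = transpose_mat A - transpose_mat K * transpose_mat B"
    using A B K by (simp add: transpose_minus[of _ n n] transpose_mult[of _ n k _ n])
  then have "transpose_mat (A - B * K) *\<^sub>v y =
      transpose_mat A *\<^sub>v y - transpose_mat K *\<^sub>v (transpose_mat B *\<^sub>v y)"
    using A B K y by (simp add: minus_mult_distrib_mat_vec[of _ n n] assoc_mult_mat_vec[of _ n k _ n])
  also have "\<dots> = l \<cdot>\<^sub>v y"
    unfolding Ay By using mult_mat_zero_vec[of "transpose_mat K" n k] K y by auto
  finally have "eigenvector (transpose_mat (A - B * K)) y l"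
    unfolding eigenvector_def using y A B K by simp
  then show ?thesis using eigenvalue_transpose[OF AK] unfolding eigenvalue_def by blast
qed

section \<open>The conserved sum of spacings\<close>

lemma sum_even_indices:
  fixes n :: nat
  shows "(\<Sum>i<2*n. if even i then f i else 0) = (\<Sum>i<n. f (2*i) :: 'a :: comm_monoid_add)"
  by (induction n) (auto simp: ac_simps)

lemma scalar_prod_even_indicator:
  fixes v :: "'a :: semiring_1 vec"
  assumes "v \<in> carrier_vec (2*n)"
  shows "vec (2*n) (\<lambda>i. if even i then 1 else 0) \<bullet> v = (\<Sum>i<n. v $ (2*i))"
  unfolding sum_even_indices[symmetric] scalar_prod_def
  by (intro sum.cong) (use assms in auto)

text \<open>Each velocity enters the equation of its own spacing with -1 and that of the follower's
  spacing with 1, so the spacing rows cancel around the ring.\<close>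

lemma mixed_A_left_kernel:
  assumes n: "n \<ge> 2"
  shows "transpose_mat (mixed_A n S a1 a2 a3) *\<^sub>v vec (2*n) (\<lambda>i. if even i then 1 else 0) = 0\<^sub>v (2*n)"
    (is "transpose_mat ?A *\<^sub>v ?w = _")
proof (rule eq_vecI)
  fix j assume "j < dim_vec (0\<^sub>v (2*n) :: real vec)"
  then have j: "j < 2*n" by simp
  have A: "dim_row ?A = 2*n" "dim_col ?A = 2*n" using mixed_A_carrier[of n S a1 a2 a3] by auto
  have col: "col ?A j \<in> carrier_vec (2*n)" using A by (intro carrier_vecI) simp
  have "(transpose_mat ?A *\<^sub>v ?w) $ j = ?w \<bullet> col ?A j"
    using A j col by (simp add: comm_scalar_prod[OF col, of ?w])
  also have "\<dots> = (\<Sum>i<n. ?A $$ (2*i, j))"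
    unfolding scalar_prod_even_indicator[OF col] using A j by simp
  also have "\<dots> = (\<Sum>i<n. if j = Suc (2*i) then -1 else if j = cyc_pred (2*n) 1 (2*i) then 1 else 0)"
    by (rule sum.cong) (use n j in \<open>auto simp: mixed_A_index\<close>)
  also have "\<dots> = 0"
  proof (cases "even j")
    case True
    then have "j \<noteq> Suc (2*i)" "j \<noteq> cyc_pred (2*n) 1 (2*i)" if "i < n" for i
      using that unfolding cyc_pred_def by (auto; presburger)+
    then show ?thesis by simp
  next
    case False
    then obtain b where b: "j = Suc (2*b)" "b < n" using j by (auto elim!: oddE)
    \<comment> \<open>The vehicle following \<open>b\<close>, with the last one followed by the
      first; \<open>n \<ge> 2\<close> makes it different from \<open>b\<close>.\<close>
    define b' where "b' = (if Suc b = n then 0 else Suc b)"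
    have b': "b' < n" "b' \<noteq> b" using n b by (auto simp: b'_def)
    have "j = cyc_pred (2*n) 1 (2*i) \<longleftrightarrow> i = b'" if "i < n" for i
      using that b unfolding cyc_pred_def b'_def by (auto; presburger)
    then have "(\<Sum>i<n. if j = Suc (2*i) then -1 else if j = cyc_pred (2*n) 1 (2*i) then 1 else 0) =
        (\<Sum>i<n. (if i = b then -1 else 0) + (if i = b' then 1 else 0 :: real))"
      using b b' by (intro sum.cong) auto
    also have "\<dots> = 0" using b b' by (simp add: sum.distrib)
    finally show ?thesis .
  qed
  finally show "(transpose_mat ?A *\<^sub>v ?w) $ j = 0\<^sub>v (2*n) $ j" using j by simp
qed (use mixed_A_carrier[of n S a1 a2 a3] in auto)

lemma mixed_B_left_kernel:
  "transpose_mat (mixed_B n S) *\<^sub>v vec (2*n) (\<lambda>i. if even i then 1 else 0) = 0\<^sub>v (card S)"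
    (is "transpose_mat ?B *\<^sub>v ?w = _")
proof (rule eq_vecI)
  fix j assume "j < dim_vec (0\<^sub>v (card S) :: real vec)"
  then have j: "j < card S" by simp
  have B: "dim_row ?B = 2*n" "dim_col ?B = card S" using mixed_B_carrier by auto
  have col: "col ?B j \<in> carrier_vec (2*n)" using B by (intro carrier_vecI) simp
  have "(transpose_mat ?B *\<^sub>v ?w) $ j = ?w \<bullet> col ?B j"
    using B j col by (simp add: comm_scalar_prod[OF col, of ?w])
  also have "\<dots> = (\<Sum>i<n. ?B $$ (2*i, j))"
    unfolding scalar_prod_even_indicator[OF col] using B j by simp
  also have "\<dots> = 0"
  proof (rule sum.neutral, safe)
    fix i assume "i < n"
    moreover have "Suc (2*i) \<noteq> 2 * m" for m by presburger
    ultimately show "?B $$ (2*i, j) = 0" using j by (simp add: mixed_B_def)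
  qed
  finally show "(transpose_mat ?B *\<^sub>v ?w) $ j = 0\<^sub>v (card S) $ j" using j by simp
qed (use mixed_B_carrier[of n S] in auto)

text \<open>The derivative of w^T x is (A^T w) . x + (B^T w) . u, which is zero for every
  input.\<close>

lemma left_kernel_conserved:
  fixes A B :: "real mat" and x u :: "real \<Rightarrow> real vec"
  assumes A: "A \<in> carrier_mat (2*n) (2*n)" and B: "B \<in> carrier_mat (2*n) k"
    and w: "w = vec (2*n) (\<lambda>i. if even i then 1 else 0)"
    and Aw: "transpose_mat A *\<^sub>v w = 0\<^sub>v (2*n)" and Bw: "transpose_mat B *\<^sub>v w = 0\<^sub>v k"
    and x: "\<And>t. x t \<in> carrier_vec (2*n)" and u: "\<And>t. u t \<in> carrier_vec k"
    and ode: "\<And>t j. j < 2*n \<Longrightarrow>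
      ((\<lambda>s. x s $ j) has_real_derivative (A *\<^sub>v x t + B *\<^sub>v u t) $ j) (at t)"
  shows "(\<Sum>i<n. x t1 $ (2*i)) = (\<Sum>i<n. x t2 $ (2*i))"
proof -
  have wc: "w \<in> carrier_vec (2*n)" using w by simp
  have "((\<lambda>s. \<Sum>i<n. x s $ (2*i)) has_real_derivative 0) (at t)" for t
  proof -
    have "((\<lambda>s. \<Sum>i<n. x s $ (2*i)) has_real_derivative (\<Sum>i<n. (A *\<^sub>v x t + B *\<^sub>v u t) $ (2*i))) (at t)"
      by (intro DERIV_sum ode) auto
    also have "(\<Sum>i<n. (A *\<^sub>v x t + B *\<^sub>v u t) $ (2*i)) = w \<bullet> (A *\<^sub>v x t + B *\<^sub>v u t)"
      unfolding w by (rule scalar_prod_even_indicator[symmetric]) (use A B x u in auto)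
    also have "\<dots> = w \<bullet> (A *\<^sub>v x t) + w \<bullet> (B *\<^sub>v u t)"
      by (rule scalar_prod_add_distrib[OF wc]) (use A B x u in auto)
    also have "\<dots> = (transpose_mat A *\<^sub>v w) \<bullet> x t + (transpose_mat B *\<^sub>v w) \<bullet> u t"
      using transpose_vec_mult_scalar[OF A x wc] transpose_vec_mult_scalar[OF B u wc] by simp
    also have "\<dots> = 0" unfolding Aw Bw using x u by simp
    finally show ?thesis .
  qed
  then show ?thesis
    using DERIV_isconst_all[of "\<lambda>s. \<Sum>i<n. x s $ (2*i)" t1 t2] by blast
qed

text \<open>The uncontrollable part is unique only up to the choice of coordinates, so its
  multiplicity is claimed for every decomposition, and existence is added to keep the claim from
  being vacuous. Both forms of stabilizability are proved outright, from the same
  \<open>K\<close>.\<close>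

theorem theorem4:
  fixes n :: nat and S :: "nat set" and a1 a2 a3 :: real and A B :: "real mat"
  assumes "n \<ge> 2" and "S \<subseteq> {1..n}" and "1 \<le> card S" and "card S < n"
    and "a1 > 0" and "a2 > a3" and "a3 > 0"
    and A_def: "A = mixed_A n S a1 a2 a3" and B_def: "B = mixed_B n S"
  shows
    "\<not> completely_controllable A B \<and>
     (let w = vec (2*n) (\<lambda>i. if even i then 1 else 0) :: real vec in
        transpose_mat A *\<^sub>v w = 0\<^sub>v (2*n) \<and> transpose_mat B *\<^sub>v w = 0\<^sub>v (card S)) \<and>
     (\<forall>(x :: real \<Rightarrow> real vec) (u :: real \<Rightarrow> real vec).
        (\<forall>t. dim_vec (x t) = 2*n \<and> dim_vec (u t) = card S \<and>
             (\<forall>j < 2*n. ((\<lambda>s. x s $ j) has_real_derivative (A *\<^sub>v x t + B *\<^sub>v u t) $ j) (at t)))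
        \<longrightarrow> (\<forall>t1 t2. (\<Sum>i<n. x t1 $ (2*i)) = (\<Sum>i<n. x t2 $ (2*i)))) \<and>
     eigenvalue (map_mat complex_of_real A) 0 \<and>
     vec_space.rank (2*n) (pbh_matrix (map_mat complex_of_real A) (map_mat complex_of_real B) 0) < 2*n \<and>
     (\<exists>T A11 A12 A22 B1. kalman_decomp A B T A11 A12 A22 B1) \<and>
     (\<forall>T A11 A12 A22 B1. kalman_decomp A B T A11 A12 A22 B1 \<longrightarrow> Polynomial.order 0 (char_poly A22) = 1) \<and>
     (\<forall>l. eigenvalue (map_mat complex_of_real A) l \<and>
          vec_space.rank (2*n) (pbh_matrix (map_mat complex_of_real A) (map_mat complex_of_real B) l) < 2*n
          \<longrightarrow> l = 0 \<or> Re l < 0) \<and>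
     (\<exists>K \<in> carrier_mat (card S) (2*n).
        Polynomial.order 0 (char_poly (A - B * K)) = 1 \<and>
        (\<forall>l. eigenvalue (map_mat complex_of_real (A - B * K)) l \<and> l \<noteq> 0 \<longrightarrow> Re l < 0))"
proof -
  let ?c = complex_of_real
  let ?Ac = "map_mat ?c A" and ?Bc = "map_mat ?c B"
  have A: "A \<in> carrier_mat (2*n) (2*n)" and B: "B \<in> carrier_mat (2*n) (card S)"
    unfolding A_def B_def by (rule mixed_A_carrier mixed_B_carrier)+
  have Ac: "?Ac \<in> carrier_mat (2*n) (2*n)" and Bc: "?Bc \<in> carrier_mat (2*n) (card S)"
    using A B by auto
  define w :: "real vec" where "w = vec (2*n) (\<lambda>i. if even i then 1 else 0)"
  have w: "w \<in> carrier_vec (2*n)" unfolding w_def by simp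
  have "w $ 0 \<noteq> 0\<^sub>v (2*n) $ 0" using assms(1) by (simp add: w_def)
  then have w0: "w \<noteq> 0\<^sub>v (2*n)" by metis
  have Aw: "transpose_mat A *\<^sub>v w = 0\<^sub>v (2*n)"
    unfolding A_def w_def by (rule mixed_A_left_kernel[OF assms(1)])
  have Bw: "transpose_mat B *\<^sub>v w = 0\<^sub>v (card S)"
    unfolding B_def w_def by (rule mixed_B_left_kernel)
  define wc where "wc = map_vec ?c w"
  have wc: "wc \<in> carrier_vec (2*n)" unfolding wc_def using w by simp
  have wc0: "wc \<noteq> 0\<^sub>v (2*n)"
    using w w0 by (auto simp: wc_def vec_eq_iff)
  \<comment> \<open>Embedding into the complex numbers commutes with the matrix action, so the real
    relations for \<open>w\<close> carry over to \<open>wc\<close>.\<close>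
  have trans: "transpose_mat (map_mat ?c M) *\<^sub>v wc = map_vec ?c (transpose_mat M *\<^sub>v w)"
    if "M \<in> carrier_mat (2*n) m" for M m
    unfolding wc_def using of_real_hom.mult_mat_vec_hom[of "transpose_mat M" m "2*n" w, where 'a = complex] that w
    by (simp add: map_mat_transpose)
  have Awc: "transpose_mat ?Ac *\<^sub>v wc = 0 \<cdot>\<^sub>v wc"
    unfolding trans[OF A] Aw using wc by auto
  have Bwc: "transpose_mat ?Bc *\<^sub>v wc = 0\<^sub>v (card S)"
    unfolding trans[OF B] Bw by auto
  have "S \<noteq> {}" using assms(3) by auto
  then obtain s where s: "s \<in> S" by blast
  \<comment> \<open>The 0-based index of the velocity of vehicle \<open>s\<close>.\<close>
  define c where "c = 2*s - 1"
  have "s \<ge> 1" "s \<le> n" using s assms(2) by auto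
  then have c: "odd c" "c < 2*n" unfolding c_def by auto
  obtain K where K: "K \<in> carrier_mat (card S) (2*n)" and AK: "A - B * K = opened_ring n c a1 a2 a3"
    using exists_opening_feedback[OF assms(1,2) s] unfolding A_def B_def c_def by blast
  have a2: "a2 > 0" using assms(6,7) by simp
  have ord: "Polynomial.order 0 (char_poly (A - B * K)) = 1"
    unfolding AK using order_zero_opened_ring[OF assms(1) c] assms(5) by simp
  have stable: "l = 0 \<or> Re l < 0" if "eigenvalue (map_mat ?c (A - B * K)) l" for l
    using eigenvalue_opened_ring[OF assms(1) c assms(5) a2] that unfolding AK by blast
  \<comment> \<open>The real feedback also serves as a complex one, so a complex left vector of the
    PBH test can be compared with the real closed loop.\<close>
  have mapAK: "map_mat ?c (A - B * K) = ?Ac - ?Bc * map_mat ?c K"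
    using of_real_hom.mat_hom_mult[OF B K, where 'a = complex] A B K
    by (intro eq_matI) (auto simp del: index_mult_mat(1) simp: of_real_hom.mat_hom_mult[symmetric])
  have P: "pbh_matrix ?Ac ?Bc 0 \<in> carrier_mat (2*n) (2*n + card S)"
    using Ac Bc by (simp add: pbh_matrix_def)
  show ?thesis
  proof (intro conjI)
    \<comment> \<open>The orbit of \<open>w\<close> is \<open>w\<close> followed by zeros, and the
      input matrix does not see \<open>w\<close>.\<close>
    have "krylov (transpose_mat A) (Suc j) w = 0\<^sub>v (2*n)" for j
      by (induction j) (use Aw A in \<open>auto simp: mult_mat_zero_vec[of _ "2*n" "2*n"]\<close>)
    then have "transpose_mat B *\<^sub>v krylov (transpose_mat A) j w = 0\<^sub>v (card S)" for j
      using Bw mult_mat_zero_vec[of "transpose_mat B" "card S" "2*n"] B by (cases j) auto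
    then show "\<not> completely_controllable A B"
      unfolding completely_controllable_iff[OF A B] using w w0 by blast
    show "let w = vec (2*n) (\<lambda>i. if even i then 1 else 0) :: real vec in
        transpose_mat A *\<^sub>v w = 0\<^sub>v (2*n) \<and> transpose_mat B *\<^sub>v w = 0\<^sub>v (card S)"
      using Aw Bw unfolding w_def Let_def by blast
    show "\<forall>(x :: real \<Rightarrow> real vec) (u :: real \<Rightarrow> real vec).
        (\<forall>t. dim_vec (x t) = 2*n \<and> dim_vec (u t) = card S \<and>
             (\<forall>j < 2*n. ((\<lambda>s. x s $ j) has_real_derivative (A *\<^sub>v x t + B *\<^sub>v u t) $ j) (at t)))
        \<longrightarrow> (\<forall>t1 t2. (\<Sum>i<n. x t1 $ (2*i)) = (\<Sum>i<n. x t2 $ (2*i)))"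
      by (intro allI impI, rule left_kernel_conserved[OF A B w_def Aw Bw]) (auto intro: carrier_vecI)
    have "eigenvector (transpose_mat ?Ac) wc 0"
      unfolding eigenvector_def using wc wc0 Awc Ac by simp
    then show "eigenvalue ?Ac 0" using eigenvalue_transpose[OF Ac] unfolding eigenvalue_def by blast
    show "vec_space.rank (2*n) (pbh_matrix ?Ac ?Bc 0) < 2*n"
      unfolding rank_less_dim_iff_left_kernel[OF P] transpose_pbh_matrix_kernel[OF Ac Bc wc]
      using transpose_pbh_matrix_kernel[OF Ac Bc wc] wc wc0 Awc Bwc by blast
    show "\<exists>T A11 A12 A22 B1. kalman_decomp A B T A11 A12 A22 B1"
      by (rule kalman_decomp_exists[OF A B])
    show "\<forall>T A11 A12 A22 B1. kalman_decomp A B T A11 A12 A22 B1 \<longrightarrow> Polynomial.order 0 (char_poly A22) = 1"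
      using kalman_uncontrollable_zero_order[OF _ A B K w w0 Aw Bw ord] by blast
    show "\<forall>l. eigenvalue ?Ac l \<and> vec_space.rank (2*n) (pbh_matrix ?Ac ?Bc l) < 2*n \<longrightarrow> l = 0 \<or> Re l < 0"
      using pbh_deficient_imp_closed_loop_eigenvalue[OF Ac Bc, of "map_mat ?c K"] K stable
      unfolding mapAK by simp
    show "\<exists>K \<in> carrier_mat (card S) (2*n).
        Polynomial.order 0 (char_poly (A - B * K)) = 1 \<and>
        (\<forall>l. eigenvalue (map_mat ?c (A - B * K)) l \<and> l \<noteq> 0 \<longrightarrow> Re l < 0)"
      using K ord stable by blast
  qed
qed

end
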